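(* Let $f_1,\dots,f_N:\mathbb{R}^n\to\mathbb{R}$ be lower semicontinuous convex functions and $f=\sum_{i=1}^N f_i$. Suppose the following hold. (A1) The set $X^*=\arg\min_{x\in\mathbb{R}^n} f(x)$ is nonempty, and there is a constant $l$ such that $\|g\|\le l$ for all $i\in\mathcal{V}=\{1,\dots,N\}$, all $x\in\mathrm{dom}(f_i)$ and all $g\in\partial f_i(x)$. (A2) $\{\mathcal{G}_1,\dots,\mathcal{G}_m\}$ is a finite set of weighted directed graphs on node set $\mathcal{V}$, each with a doubly stochastic adjacency matrix $A_{\mathcal{G}_r}$; the union graph with edge set $\bigcup_{r=1}^m\mathcal{E}_{\mathcal{G}_r}$ is strongly connected; and $\theta(k)$, $k=0,1,2,\dots$, is an irreducible Markov chain on $\{1,\dots,m\}$ with stationary (time-homogeneous) transition matrix $P$. (A3) $\alpha_k=\dfrac{a_1}{(k+1)^{\delta_1}}$ and $\beta_k=\dfrac{a_2}{(k+1)^{\delta_2}}$ with $a_1>0$, $a_2>0$, $0<\delta_1<\delta_2\le 1$ and $\delta_2-\delta_1\ge\frac12$. Let $x_i(k)$, $i\in\mathcal{V}$, be generated from initial states $x_i(0)\in\mathbb{R}^n$ by $$x_i(k+1)=x_i(k)+\alpha_k\sum_{j=1}^N a_{ij}(k)\,(x_j(k)-x_i(k))-\beta_k d_i(k),\qquad k=0,1,2,\dots,$$ where $a_{ij}(k)$ is the $(i,j)$ entry of $A_{\mathcal{G}_{\theta(k)}}$ and $d_i(k)\in\partial f_i(x_i(k))$. Then almost surely all the agents'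 states converge to the same optimal solution: with probability 1 there exists $x^*\in X^*$ (possibly depending on the sample path, but not on $i$) such that $$\lim_{k\to\infty}x_i(k)=x^*\qquad\text{for all } i\in\mathcal{V}.$$
   Context: A weighted directed graph $\mathcal{G}=\{\mathcal{V},\mathcal{E}_{\mathcal{G}},A_{\mathcal{G}}\}$ has node set $\mathcal{V}=\{1,\dots,N\}$, edge set $\mathcal{E}_{\mathcal{G}}\subset\mathcal{V}\times\mathcal{V}$ and a nonnegative row stochastic adjacency matrix $A_{\mathcal{G}}=[a_{ij}]\in\mathbb{R}^{N\times N}$ with $0<a_{ij}\le1$ if $(j,i)\in\mathcal{E}_{\mathcal{G}}$ and $a_{ij}=0$ otherwise. A matrix is doubly stochastic if it is nonnegative and all its row sums and column sums equal 1. A directed graph is strongly connected if for any two nodes there is a directed path from each to the other. $\partial f_i(x)$ is the convex subdifferential and $\|\cdot\|$ is the Euclidean norm. The initial states $x_i(0)$ are deterministic. All randomness is on one probability space carrying the Markov chain $\theta(k)$; the initial distribution of $\theta(0)$ is arbitrary, and $d_i(k)$ is any subgradient selection for which $x_i(k)$, $d_i(k)$ are random vectors. *)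

theory Defs
  imports "HOL-Probability.Probability" "Graph_Theory.Graph_Theory"
begin

definition lower_semicontinuous :: "('a::topological_space \<Rightarrow> real) \<Rightarrow> bool" where
  "lower_semicontinuous f \<longleftrightarrow> (\<forall>x. \<forall>c < f x. \<forall>\<^sub>F y in nhds x. c < f y)"

definition subdifferential :: "('a::real_inner \<Rightarrow> real) \<Rightarrow> 'a \<Rightarrow> 'a set" where
  "subdifferential f x = {g. \<forall>y. f y \<ge> f x + g \<bullet> (y - x)}"

text \<open>
  A matrix indexed by a finite set \<open>V\<close> is a function \<open>A :: 'v \<Rightarrow> 'v \<Rightarrow> real\<close> of which only
  the values on \<open>V\<close> matter.
\<close>

definition row_stochastic :: "'v set \<Rightarrow> ('v \<Rightarrow> 'v \<Rightarrow> real) \<Rightarrow> bool" where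
  "row_stochastic V A \<longleftrightarrow>
     (\<forall>i\<in>V. \<forall>j\<in>V. 0 \<le> A i j) \<and> (\<forall>i\<in>V. (\<Sum>j\<in>V. A i j) = 1)"

definition doubly_stochastic :: "'v set \<Rightarrow> ('v \<Rightarrow> 'v \<Rightarrow> real) \<Rightarrow> bool" where
  "doubly_stochastic V A \<longleftrightarrow>
     (\<forall>i\<in>V. \<forall>j\<in>V. 0 \<le> A i j) \<and>
     (\<forall>i\<in>V. (\<Sum>j\<in>V. A i j) = 1) \<and> (\<forall>j\<in>V. (\<Sum>i\<in>V. A i j) = 1)"

record 'v weighted_digraph =
  edges :: "('v \<times> 'v) set"
  adj :: "'v \<Rightarrow> 'v \<Rightarrow> real"

text \<open>
  The entry \<open>adj G i j\<close> is the weight of the edge from \<open>j\<close> to \<open>i\<close>. Self-loops are allowed,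
  but not required.
\<close>

definition weighted_digraph :: "'v set \<Rightarrow> 'v weighted_digraph \<Rightarrow> bool" where
  "weighted_digraph V G \<longleftrightarrow>
     edges G \<subseteq> V \<times> V \<and>
     (\<forall>i\<in>V. \<forall>j\<in>V. if (j, i) \<in> edges G then 0 < adj G i j \<and> adj G i j \<le> 1 else adj G i j = 0) \<and>
     row_stochastic V (adj G)"

fun transition_prob :: "'s set \<Rightarrow> ('s \<Rightarrow> 's \<Rightarrow> real) \<Rightarrow> nat \<Rightarrow> 's \<Rightarrow> 's \<Rightarrow> real" where
  "transition_prob S P 0 i j = (if i = j then 1 else 0)"
| "transition_prob S P (Suc n) i j = (\<Sum>l\<in>S. transition_prob S P n i l * P l j)"

definition irreducible_transitions :: "'s set \<Rightarrow> ('s \<Rightarrow> 's \<Rightarrow> real) \<Rightarrow> bool" where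
  "irreducible_transitions S P \<longleftrightarrow> (\<forall>i\<in>S. \<forall>j\<in>S. \<exists>n. transition_prob S P n i j > 0)"

text \<open>
  A time-homogeneous Markov chain with transition matrix \<open>P\<close> on a finite state space \<open>S\<close>:
  conditionally on any history of positive probability, the next state is distributed
  according to the row of \<open>P\<close> given by the current state. The distribution of \<open>X 0\<close> is
  arbitrary, and the Markov property refers to the history of \<open>X\<close> only.
\<close>

definition markov_chain ::
  "'w measure \<Rightarrow> 's set \<Rightarrow> ('s \<Rightarrow> 's \<Rightarrow> real) \<Rightarrow> (nat \<Rightarrow> 'w \<Rightarrow> 's) \<Rightarrow> bool" where
  "markov_chain M S P X \<longleftrightarrow>
     row_stochastic S P \<and>
     (\<forall>k. X k \<in> M \<rightarrow>\<^sub>M count_space S) \<and>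
     (\<forall>k s. \<forall>j\<in>S. \<P>(\<omega> in M. \<forall>t\<le>k. X t \<omega> = s t) > 0 \<longrightarrow>
        \<P>(\<omega> in M. X (Suc k) \<omega> = j \<bar> \<forall>t\<le>k. X t \<omega> = s t) = P (s k) j)"

end

theory Submission
  imports Defs
begin

text \<open>
  By double stochasticity the average \<open>q k\<close> of the agents moves only by the subgradients, and the
  deviations \<open>\<eta> k i = x i k - q k\<close> satisfy a linear averaging recursion with noise of size
  \<open>O(\<beta> k)\<close>. By irreducibility there are \<open>h\<close> and \<open>p > 0\<close> such that any block of \<open>h\<close> steps visits
  all graphs with conditional probability at least \<open>p\<close>; in such a block the Euclidean norm of
  \<open>\<eta>\<close> contracts by a factor \<open>1 - c \<alpha>\<close>, and otherwise it grows by at most \<open>O(\<beta>)\<close>. Weighting the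
  expected decrease by \<open>\<beta> / \<alpha>\<close> and telescoping gives \<open>E (\<Sum>k. \<beta> k * norm (\<eta> k)) < \<infinity>\<close>, because
  \<open>\<beta>\<^sup>2 / \<alpha>\<close> is summable when \<open>\<delta>\<^sub>2 - \<delta>\<^sub>1 \<ge> 1 / 2\<close> and \<open>\<delta>\<^sub>1 > 0\<close>. On a path with
  \<open>(\<Sum>k. \<beta> k * norm (\<eta> k)) < \<infinity>\<close>, \<open>q\<close> follows a perturbed subgradient method with summable errors:
  its distance to every minimiser converges and some subsequence converges to a minimiser.
\<close>

subsection \<open>Averaging by doubly stochastic matrices\<close>

text \<open>Norm of the whole family as one stacked vector of a Euclidean product space. Tracking
  the norm instead of its square lets noise enter additively.\<close>

definition L2_vec :: "'v set \<Rightarrow> ('v \<Rightarrow> 'a::real_normed_vector) \<Rightarrow> real" where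
  "L2_vec V z = L2_set (\<lambda>i. norm (z i)) V"

lemma L2_vec_nonneg [simp]: "0 \<le> L2_vec V z"
  by (simp add: L2_vec_def)

lemma L2_vec_cong: "(\<And>i. i \<in> V \<Longrightarrow> y i = z i) \<Longrightarrow> L2_vec V y = L2_vec V z"
  unfolding L2_vec_def by (rule L2_set_cong) auto

lemma L2_vec_power2: "(L2_vec V z)\<^sup>2 = (\<Sum>i\<in>V. (norm (z i))\<^sup>2)"
  by (simp add: L2_vec_def L2_set_def sum_nonneg)

lemma norm_le_L2_vec: "finite V \<Longrightarrow> i \<in> V \<Longrightarrow> norm (z i) \<le> L2_vec V z"
  unfolding L2_vec_def by (rule member_le_L2_set)

lemma L2_vec_le_sum: "L2_vec V z \<le> (\<Sum>i\<in>V. norm (z i))"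
  using L2_set_le_sum_abs[of "\<lambda>i. norm (z i)" V] by (simp add: L2_vec_def)

lemma L2_vec_zero [simp]: "L2_vec V (\<lambda>i. 0) = 0"
  by (simp add: L2_vec_def L2_set_def)

lemma L2_vec_add: "L2_vec V (\<lambda>i. y i + z i) \<le> L2_vec V y + L2_vec V z"
proof -
  have "L2_vec V (\<lambda>i. y i + z i) \<le> L2_set (\<lambda>i. norm (y i) + norm (z i)) V"
    unfolding L2_vec_def by (intro L2_set_mono norm_triangle_ineq norm_ge_zero)
  also have "\<dots> \<le> L2_vec V y + L2_vec V z"
    unfolding L2_vec_def by (rule L2_set_triangle_ineq)
  finally show ?thesis .
qed

lemma L2_vec_scaleR: "L2_vec V (\<lambda>i. c *\<^sub>R z i) = \<bar>c\<bar> * L2_vec V z"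
  unfolding L2_vec_def by (simp add: L2_set_right_distrib)

lemma L2_vec_diff: "L2_vec V (\<lambda>i. y i - z i) \<le> L2_vec V y + L2_vec V z"
  using L2_vec_add[of V y "\<lambda>i. (-1) *\<^sub>R z i"] L2_vec_scaleR[of V "-1" z] by simp

lemma L2_vec_sum: "L2_vec V (\<lambda>i. \<Sum>s\<in>S. y s i) \<le> (\<Sum>s\<in>S. L2_vec V (y s))"
proof (induction S rule: infinite_finite_induct)
  case (insert s S)
  then show ?case
    using L2_vec_add[of V "y s" "\<lambda>i. \<Sum>s\<in>S. y s i"] by simp
qed auto

text \<open>The sign is opposite to that of the usual graph Laplacian, so that an averaging step
  adds a nonnegative multiple of it.\<close>

definition laplacian :: "'v set \<Rightarrow> ('v \<Rightarrow> 'v \<Rightarrow> real) \<Rightarrow> ('v \<Rightarrow> 'a::real_vector) \<Rightarrow> 'v \<Rightarrow> 'a" where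
  "laplacian V A z i = (\<Sum>j\<in>V. A i j *\<^sub>R (z j - z i))"

text \<open>The Dirichlet form of the weights, summed over ordered pairs; hence the factor 1/2 in
  \<open>inner_laplacian\<close>.\<close>

definition disagreement :: "'v set \<Rightarrow> ('v \<Rightarrow> 'v \<Rightarrow> real) \<Rightarrow> ('v \<Rightarrow> 'a::real_normed_vector) \<Rightarrow> real" where
  "disagreement V A z = (\<Sum>i\<in>V. \<Sum>j\<in>V. A i j * (norm (z i - z j))\<^sup>2)"

lemma laplacian_diff:
  "laplacian V A (\<lambda>i. y i - z i) i = laplacian V A y i - laplacian V A z i"
  by (simp add: laplacian_def sum_subtractf[symmetric] algebra_simps)

lemma laplacian_translate: "laplacian V A (\<lambda>i. z i - c) i = laplacian V A z i"
  by (simp add: laplacian_def)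

context
  fixes V :: "'v set" and A :: "'v \<Rightarrow> 'v \<Rightarrow> real"
  assumes doubly: "doubly_stochastic V A"
begin

lemma doubly_nonneg: "i \<in> V \<Longrightarrow> j \<in> V \<Longrightarrow> 0 \<le> A i j"
  and doubly_row: "i \<in> V \<Longrightarrow> (\<Sum>j\<in>V. A i j) = 1"
  and doubly_col: "j \<in> V \<Longrightarrow> (\<Sum>i\<in>V. A i j) = 1"
  using doubly by (auto simp: doubly_stochastic_def)

lemma doubly_row_sum:
  fixes w :: "'v \<Rightarrow> 'a::real_vector"
  shows "(\<Sum>i\<in>V. \<Sum>j\<in>V. A i j *\<^sub>R w i) = (\<Sum>i\<in>V. w i)"
  by (intro sum.cong refl) (simp add: scaleR_sum_left[symmetric] doubly_row)

lemma doubly_col_sum: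
  fixes w :: "'v \<Rightarrow> 'a::real_vector"
  shows "(\<Sum>i\<in>V. \<Sum>j\<in>V. A i j *\<^sub>R w j) = (\<Sum>i\<in>V. w i)"
  by (subst sum.swap, intro sum.cong refl) (simp add: scaleR_sum_left[symmetric] doubly_col)

lemma sum_laplacian:
  fixes z :: "'v \<Rightarrow> 'a::real_vector"
  shows "(\<Sum>i\<in>V. laplacian V A z i) = 0"
  by (simp add: laplacian_def scaleR_diff_right sum_subtractf doubly_row_sum doubly_col_sum)

lemma laplacian_eq:
  fixes z :: "'v \<Rightarrow> 'a::real_vector"
  shows "i \<in> V \<Longrightarrow> laplacian V A z i = (\<Sum>j\<in>V. A i j *\<^sub>R z j) - z i"
  by (simp add: laplacian_def scaleR_diff_right sum_subtractf scaleR_sum_left[symmetric] doubly_row)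

text \<open>Row sums 1 give Jensen's inequality for the square in every component; column sums 1
  then make the averaged squares add up to the original total.\<close>

lemma L2_vec_averaging:
  fixes z :: "'v \<Rightarrow> 'a::real_inner"
  assumes "finite V"
  shows "L2_vec V (\<lambda>i. \<Sum>j\<in>V. A i j *\<^sub>R z j) \<le> L2_vec V z"
proof (rule power2_le_imp_le)
  have "(norm (\<Sum>j\<in>V. A i j *\<^sub>R z j))\<^sup>2 \<le> (\<Sum>j\<in>V. A i j * (norm (z j))\<^sup>2)" if "i \<in> V" for i
  proof -
    have "norm (\<Sum>j\<in>V. A i j *\<^sub>R z j) \<le> (\<Sum>j\<in>V. A i j * norm (z j))"
      by (rule order_trans[OF norm_sum])
         (use doubly_nonneg that in \<open>auto intro!: sum_mono\<close>)
    then have "(norm (\<Sum>j\<in>V. A i j *\<^sub>R z j))\<^sup>2 \<le> (\<Sum>j\<in>V. A i j * norm (z j))\<^sup>2"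
      by (intro power_mono) auto
    also have "\<dots> \<le> (\<Sum>j\<in>V. A i j * (norm (z j))\<^sup>2)"
      using convex_on_sum[OF assms _ convex_power2, of "A i" "\<lambda>j. norm (z j)"]
        doubly_row[OF that] doubly_nonneg[OF that] that by auto
    finally show ?thesis .
  qed
  then have "(L2_vec V (\<lambda>i. \<Sum>j\<in>V. A i j *\<^sub>R z j))\<^sup>2 \<le> (\<Sum>i\<in>V. \<Sum>j\<in>V. A i j * (norm (z j))\<^sup>2)"
    unfolding L2_vec_power2 by (rule sum_mono)
  also have "\<dots> = (L2_vec V z)\<^sup>2"
    using doubly_col_sum[of "\<lambda>j. (norm (z j))\<^sup>2"] by (simp add: L2_vec_power2)
  finally show "(L2_vec V (\<lambda>i. \<Sum>j\<in>V. A i j *\<^sub>R z j))\<^sup>2 \<le> (L2_vec V z)\<^sup>2" .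
qed auto

lemma L2_vec_laplacian:
  fixes z :: "'v \<Rightarrow> 'a::real_inner"
  assumes "finite V"
  shows "L2_vec V (laplacian V A z) \<le> 2 * L2_vec V z"
proof -
  have "L2_vec V (laplacian V A z) = L2_vec V (\<lambda>i. (\<Sum>j\<in>V. A i j *\<^sub>R z j) - z i)"
    by (rule L2_vec_cong) (rule laplacian_eq)
  also have "\<dots> \<le> 2 * L2_vec V z"
    using L2_vec_diff[of V "\<lambda>i. \<Sum>j\<in>V. A i j *\<^sub>R z j" z] L2_vec_averaging[OF assms, of z] by simp
  finally show ?thesis .
qed

text \<open>The step is the convex combination of \<open>z\<close> and its average with weights
  \<open>1 - a\<close> and \<open>a\<close>, and both have norm at most that of
  \<open>z\<close>.\<close>

lemma L2_vec_lazy_averaging: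
  fixes z :: "'v \<Rightarrow> 'a::real_inner"
  assumes "finite V" "0 \<le> a" "a \<le> 1"
  shows "L2_vec V (\<lambda>i. z i + a *\<^sub>R laplacian V A z i) \<le> L2_vec V z"
proof -
  have "L2_vec V (\<lambda>i. z i + a *\<^sub>R laplacian V A z i)
      = L2_vec V (\<lambda>i. (1 - a) *\<^sub>R z i + a *\<^sub>R (\<Sum>j\<in>V. A i j *\<^sub>R z j))"
    by (rule L2_vec_cong) (simp add: laplacian_eq algebra_simps)
  also have "\<dots> \<le> (1 - a) * L2_vec V z + a * L2_vec V (\<lambda>i. \<Sum>j\<in>V. A i j *\<^sub>R z j)"
    using L2_vec_add[of V "\<lambda>i. (1 - a) *\<^sub>R z i" "\<lambda>i. a *\<^sub>R (\<Sum>j\<in>V. A i j *\<^sub>R z j)"] assms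
    by (simp add: L2_vec_scaleR)
  also have "\<dots> \<le> (1 - a) * L2_vec V z + a * L2_vec V z"
    using L2_vec_averaging[OF assms(1), of z] assms by (intro add_left_mono mult_left_mono) auto
  finally show ?thesis by (simp add: algebra_simps)
qed

text \<open>Expand the squares in the disagreement: row sums and column sums turn the two diagonal
  terms into the same sum of squares. Balance of rows and columns plays the part that symmetry has
  for undirected graphs.\<close>

lemma inner_laplacian:
  fixes z :: "'v \<Rightarrow> 'a::real_inner"
  shows "(\<Sum>i\<in>V. laplacian V A z i \<bullet> z i) = - disagreement V A z / 2"
proof -
  have "disagreement V A z = (\<Sum>i\<in>V. \<Sum>j\<in>V. A i j *\<^sub>R (norm (z i))\<^sup>2)
      + (\<Sum>i\<in>V. \<Sum>j\<in>V. A i j *\<^sub>R (norm (z j))\<^sup>2) - 2 * (\<Sum>i\<in>V. \<Sum>j\<in>V. A i j * (z j \<bullet> z i))"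
    unfolding disagreement_def sum_distrib_left sum.distrib[symmetric] sum_subtractf[symmetric]
    by (intro sum.cong refl) (simp add: power2_norm_eq_inner inner_diff inner_commute algebra_simps)
  also have "\<dots> = 2 * (\<Sum>i\<in>V. \<Sum>j\<in>V. A i j *\<^sub>R (norm (z i))\<^sup>2)
      - 2 * (\<Sum>i\<in>V. \<Sum>j\<in>V. A i j * (z j \<bullet> z i))"
    using doubly_row_sum[of "\<lambda>i. (norm (z i))\<^sup>2"] doubly_col_sum[of "\<lambda>i. (norm (z i))\<^sup>2"] by simp
  also have "\<dots> = - 2 * (\<Sum>i\<in>V. laplacian V A z i \<bullet> z i)"
    unfolding laplacian_def inner_sum_left sum_distrib_left sum_subtractf[symmetric]
    by (intro sum.cong refl)
       (simp add: power2_norm_eq_inner inner_diff algebra_simps)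
  finally show ?thesis by simp
qed

lemma disagreement_nonneg: "0 \<le> disagreement V A z"
  unfolding disagreement_def by (intro sum_nonneg mult_nonneg_nonneg doubly_nonneg) auto

end

text \<open>The cross terms add up to the inner product of the total with itself, which vanishes for
  a centred family.\<close>

lemma sum_norm_diff_power2:
  fixes z :: "'v \<Rightarrow> 'a::real_inner"
  assumes "(\<Sum>i\<in>V. z i) = 0"
  shows "(\<Sum>i\<in>V. \<Sum>j\<in>V. (norm (z i - z j))\<^sup>2) = 2 * real (card V) * (L2_vec V z)\<^sup>2"
proof -
  have "(\<Sum>i\<in>V. \<Sum>j\<in>V. (norm (z i - z j))\<^sup>2)
      = (\<Sum>i\<in>V. \<Sum>j\<in>V. (norm (z i))\<^sup>2) + (\<Sum>i\<in>V. \<Sum>j\<in>V. (norm (z j))\<^sup>2)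
        - 2 * (\<Sum>i\<in>V. \<Sum>j\<in>V. z i \<bullet> z j)"
    unfolding sum_distrib_left sum.distrib[symmetric] sum_subtractf[symmetric]
    by (intro sum.cong refl) (simp add: power2_norm_eq_inner inner_diff inner_commute)
  also have "(\<Sum>i\<in>V. \<Sum>j\<in>V. z i \<bullet> z j) = (\<Sum>i\<in>V. z i) \<bullet> (\<Sum>j\<in>V. z j)"
    unfolding inner_sum_left inner_sum_right by (rule sum.swap)
  finally show ?thesis
    by (simp add: assms L2_vec_power2 sum_distrib_left[symmetric])
qed

text \<open>A Poincare inequality. Any difference \<open>z i - z j\<close> is controlled along a
  directed path by differences over single edges, and each of these by the disagreement; summing
  over all pairs recovers the norm. It will be applied to the sum of the weight matrices, whose
  positive entries mark the edges of the union graph.\<close>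

lemma disagreement_ge:
  fixes W :: "'v \<Rightarrow> 'v \<Rightarrow> real"
  assumes V: "finite V" "V \<noteq> {}"
    and nonneg: "\<And>i j. i \<in> V \<Longrightarrow> j \<in> V \<Longrightarrow> 0 \<le> W i j"
    and conn: "\<And>i j. i \<in> V \<Longrightarrow> j \<in> V \<Longrightarrow> (i, j) \<in> {(j, i). i \<in> V \<and> j \<in> V \<and> 0 < W i j}\<^sup>*"
  obtains c where "c > 0"
    "\<And>z :: 'v \<Rightarrow> 'a::real_inner. (\<Sum>i\<in>V. z i) = 0 \<Longrightarrow> c * (L2_vec V z)\<^sup>2 \<le> disagreement V W z"
proof -
  define D :: "('v \<Rightarrow> 'a) \<Rightarrow> real" where "D = disagreement V W"
  have edge: "W i j * (norm (z i - z j))\<^sup>2 \<le> D z" if "i \<in> V" "j \<in> V" for i j and z :: "'v \<Rightarrow> 'a"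
  proof -
    have "W i j * (norm (z i - z j))\<^sup>2 \<le> (\<Sum>j\<in>V. W i j * (norm (z i - z j))\<^sup>2)"
      using that V nonneg by (intro member_le_sum) auto
    also have "\<dots> \<le> D z" unfolding D_def disagreement_def
      using that V nonneg
      by (intro member_le_sum[where f="\<lambda>i. \<Sum>j\<in>V. W i j * (norm (z i - z j))\<^sup>2"]) (auto intro!: sum_nonneg)
    finally show ?thesis .
  qed
  have "\<exists>K\<ge>0. \<forall>z :: 'v \<Rightarrow> 'a. (norm (z i - z j))\<^sup>2 \<le> K * D z"
    if "(i, j) \<in> {(j, i). i \<in> V \<and> j \<in> V \<and> 0 < W i j}\<^sup>*" for i j
    using that
  proof induction
    case base
    then show ?case by (intro exI[of _ 0]) auto
  next
    case (step j k)
    then obtain K where K: "K \<ge> 0" "\<And>z :: 'v \<Rightarrow> 'a. (norm (z i - z j))\<^sup>2 \<le> K * D z" by auto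
    have W: "W k j > 0" "k \<in> V" "j \<in> V" using step by auto
    \<comment> \<open>The square of a sum is at most twice the sum of the squares: the path so far
      contributes \<open>2 * K\<close>, the new edge \<open>2 / W k j\<close>.\<close>
    have "(norm (z i - z k))\<^sup>2 \<le> (2 * K + 2 / W k j) * D z" for z :: "'v \<Rightarrow> 'a"
    proof -
      have "(norm (z i - z k))\<^sup>2 \<le> (norm (z i - z j) + norm (z k - z j))\<^sup>2"
        by (intro power_mono) (metis norm_triangle_ineq4 diff_diff_eq2 add_diff_cancel_right' diff_add_cancel, simp)
      also have "\<dots> \<le> 2 * (norm (z i - z j))\<^sup>2 + 2 * (norm (z k - z j))\<^sup>2"
        using sum_squares_bound[of "norm (z i - z j)" "norm (z k - z j)"] by (simp add: power2_sum)
      also have "\<dots> \<le> 2 * (K * D z) + 2 * (D z / W k j)"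
      proof (intro add_mono mult_left_mono)
        show "(norm (z k - z j))\<^sup>2 \<le> D z / W k j"
          using edge[of k j z] W by (simp add: pos_le_divide_eq mult.commute)
      qed (use K(2) in auto)
      finally show ?thesis by (simp add: algebra_simps)
    qed
    then show ?case using K(1) W by (intro exI[of _ "2 * K + 2 / W k j"]) auto
  qed
  then have "\<forall>i\<in>V. \<forall>j\<in>V. \<exists>K\<ge>0. \<forall>z :: 'v \<Rightarrow> 'a. (norm (z i - z j))\<^sup>2 \<le> K * D z"
    using conn by blast
  then obtain K where K: "\<And>i j. i \<in> V \<Longrightarrow> j \<in> V \<Longrightarrow> 0 \<le> K i j"
    "\<And>i j z. i \<in> V \<Longrightarrow> j \<in> V \<Longrightarrow> (norm (z i - z j))\<^sup>2 \<le> K i j * D z"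
    by (metis (no_types))
  \<comment> \<open>The summand 1 makes \<open>T\<close> positive even if all \<open>K i j\<close>
    are 0.\<close>
  define T where "T = 1 + (\<Sum>i\<in>V. \<Sum>j\<in>V. K i j)"
  have "T > 0" unfolding T_def using K(1) by (intro add_pos_nonneg sum_nonneg) auto
  have D0: "0 \<le> D z" for z unfolding D_def disagreement_def
    using nonneg by (intro sum_nonneg mult_nonneg_nonneg) auto
  have card: "0 < card V" using V by (simp add: card_gt_0_iff)
  show thesis
  proof (rule that)
    show "2 * real (card V) / T > 0" using \<open>T > 0\<close> card by simp
    fix z :: "'v \<Rightarrow> 'a" assume "(\<Sum>i\<in>V. z i) = 0"
    then have "2 * real (card V) * (L2_vec V z)\<^sup>2 = (\<Sum>i\<in>V. \<Sum>j\<in>V. (norm (z i - z j))\<^sup>2)"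
      by (simp add: sum_norm_diff_power2)
    also have "\<dots> \<le> (\<Sum>i\<in>V. \<Sum>j\<in>V. K i j * D z)"
      using K(2) by (intro sum_mono) auto
    also have "\<dots> = (T - 1) * D z"
      by (simp add: T_def sum_distrib_right)
    also have "\<dots> \<le> T * D z"
      using D0[of z] by (simp add: algebra_simps)
    finally show "2 * real (card V) / T * (L2_vec V z)\<^sup>2 \<le> disagreement V W z"
      using \<open>T > 0\<close> by (simp add: D_def field_simps)
  qed
qed

subsection \<open>Contraction over a block of averaging steps\<close>

context
  fixes V :: "'v set" and \<alpha> :: "nat \<Rightarrow> real" and B :: "nat \<Rightarrow> 'v \<Rightarrow> 'v \<Rightarrow> real"
    and z p :: "nat \<Rightarrow> 'v \<Rightarrow> 'a::real_inner" and h :: nat and a \<epsilon> :: real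
  assumes V: "finite V"
    and doubly: "\<And>s. s < h \<Longrightarrow> doubly_stochastic V (B s)"
    and gain: "\<And>s. s < h \<Longrightarrow> 0 \<le> \<alpha> s" "\<And>s. s < h \<Longrightarrow> \<alpha> s \<le> a" "a \<le> 1"
    and step: "\<And>s i. s < h \<Longrightarrow> i \<in> V \<Longrightarrow> z (Suc s) i = z s i + \<alpha> s *\<^sub>R laplacian V (B s) (z s) i + p s i"
    and noise: "\<And>s. s < h \<Longrightarrow> L2_vec V (p s) \<le> \<epsilon>" "0 \<le> \<epsilon>"
begin

text \<open>Lazy averaging does not increase the norm, so only the noise can.\<close>

lemma perturbed_averaging_bound: "s \<le> h \<Longrightarrow> L2_vec V (z s) \<le> L2_vec V (z 0) + real s * \<epsilon>"
proof (induction s)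
  case (Suc s)
  have "L2_vec V (z (Suc s)) = L2_vec V (\<lambda>i. (z s i + \<alpha> s *\<^sub>R laplacian V (B s) (z s) i) + p s i)"
    by (rule L2_vec_cong) (use Suc.prems step in auto)
  also have "\<dots> \<le> L2_vec V (\<lambda>i. z s i + \<alpha> s *\<^sub>R laplacian V (B s) (z s) i) + L2_vec V (p s)"
    by (rule L2_vec_add)
  also have "\<dots> \<le> L2_vec V (z s) + \<epsilon>"
    using gain(1,2)[of s] gain(3) Suc.prems
    by (intro add_mono noise L2_vec_lazy_averaging doubly V) auto
  finally show ?case using Suc by (simp add: algebra_simps)
qed simp

lemma perturbed_averaging_sum:
  "s \<le> h \<Longrightarrow> i \<in> V \<Longrightarrow> z s i = z 0 i + (\<Sum>t<s. \<alpha> t *\<^sub>R laplacian V (B t) (z t) i + p t i)"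
  by (induction s) (auto simp: step)

text \<open>Every step moves the state by at most the gain times twice its norm, plus noise. Over a
  block the state thus stays within first order in \<open>a\<close> and \<open>\<epsilon>\<close> of
  its initial value, which allows the Laplacians to be frozen there.\<close>

lemma perturbed_averaging_drift:
  assumes "0 \<le> a" "s \<le> h"
  shows "L2_vec V (\<lambda>i. z s i - z 0 i)
      \<le> real h * (2 * a * L2_vec V (z 0) + (2 * real h + 1) * \<epsilon>)"
proof -
  have *: "L2_vec V (\<lambda>i. \<alpha> t *\<^sub>R laplacian V (B t) (z t) i + p t i)
      \<le> 2 * a * L2_vec V (z 0) + (2 * real h + 1) * \<epsilon>" if "t < h" for t
  proof -
    have z: "L2_vec V (z t) \<le> L2_vec V (z 0) + real h * \<epsilon>"
      using perturbed_averaging_bound[of t] that noise(2) mult_right_mono[of "real t" "real h" \<epsilon>] by simp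
    have "L2_vec V (\<lambda>i. \<alpha> t *\<^sub>R laplacian V (B t) (z t) i + p t i)
        \<le> \<alpha> t * L2_vec V (laplacian V (B t) (z t)) + L2_vec V (p t)"
      using L2_vec_add[of V "\<lambda>i. \<alpha> t *\<^sub>R laplacian V (B t) (z t) i" "p t"] gain(1)[OF that]
      by (simp add: L2_vec_scaleR)
    also have "\<dots> \<le> a * (2 * L2_vec V (z t)) + \<epsilon>"
      by (intro add_mono mult_mono gain(2) noise(1) L2_vec_laplacian doubly V that assms) auto
    also have "\<dots> \<le> a * (2 * (L2_vec V (z 0) + real h * \<epsilon>)) + \<epsilon>"
      using z assms by (intro add_mono mult_left_mono) auto
    \<comment> \<open>Here \<open>a \<le> 1\<close> absorbs the gain in front of the accumulated
      noise.\<close>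
    also have "\<dots> \<le> 2 * a * L2_vec V (z 0) + 2 * (1 * (real h * \<epsilon>)) + \<epsilon>"
      using mult_right_mono[OF gain(3), of "real h * \<epsilon>"] noise(2) by (simp add: algebra_simps)
    finally show ?thesis by (simp add: algebra_simps)
  qed
  have "L2_vec V (\<lambda>i. z s i - z 0 i) = L2_vec V (\<lambda>i. \<Sum>t<s. \<alpha> t *\<^sub>R laplacian V (B t) (z t) i + p t i)"
    by (rule L2_vec_cong) (simp add: perturbed_averaging_sum[OF assms(2)])
  also have "\<dots> \<le> (\<Sum>t<s. L2_vec V (\<lambda>i. \<alpha> t *\<^sub>R laplacian V (B t) (z t) i + p t i))"
    by (rule L2_vec_sum)
  also have "\<dots> \<le> (\<Sum>t<s. 2 * a * L2_vec V (z 0) + (2 * real h + 1) * \<epsilon>)"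
    by (intro sum_mono *) (use assms in auto)
  also have "\<dots> = real s * (2 * a * L2_vec V (z 0) + (2 * real h + 1) * \<epsilon>)"
    by simp
  also have "\<dots> \<le> real h * (2 * a * L2_vec V (z 0) + (2 * real h + 1) * \<epsilon>)"
    using assms noise(2) by (intro mult_right_mono) (auto intro!: add_nonneg_nonneg mult_nonneg_nonneg)
  finally show ?thesis .
qed

text \<open>
  To first order in the gains, a block of averaging steps acts like a single step in which all
  Laplacians are applied to the initial vector.
\<close>

lemma frozen_averaging_contraction:
  fixes y :: "'v \<Rightarrow> 'a"
  assumes R: "finite R" "R \<noteq> {}" and visit: "\<And>r. r \<in> R \<Longrightarrow> \<exists>s<h. B s = A r"
    and \<kappa>: "0 < \<kappa>" "\<And>s. s < h \<Longrightarrow> \<kappa> * a \<le> \<alpha> s"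
    and a: "0 \<le> a" "c * \<kappa> / real (card R) * a \<le> 1"
    and c: "0 < c" "c * (L2_vec V y)\<^sup>2 \<le> (\<Sum>r\<in>R. disagreement V (A r) y)"
  shows "L2_vec V (\<lambda>i. y i + (\<Sum>s<h. \<alpha> s *\<^sub>R laplacian V (B s) y i))
      \<le> (1 - c * \<kappa> / (2 * real (card R)) * a + 2 * (real h)\<^sup>2 * a\<^sup>2) * L2_vec V y"
proof -
  \<comment> \<open>To first order in \<open>a\<close>, \<open>b\<close> is the relative decrease of
    the squared norm; passing to the norm halves it.\<close>
  define b where "b = c * \<kappa> / real (card R) * a"
  define L where "L i = (\<Sum>s<h. \<alpha> s *\<^sub>R laplacian V (B s) y i)" for i
  have card: "0 < card R" using R by (simp add: card_gt_0_iff)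
  have "L2_vec V L \<le> (\<Sum>s<h. L2_vec V (\<lambda>i. \<alpha> s *\<^sub>R laplacian V (B s) y i))"
    unfolding L_def by (rule L2_vec_sum)
  also have "\<dots> \<le> (\<Sum>s<h. a * (2 * L2_vec V y))"
    unfolding L2_vec_scaleR using gain a
    by (intro sum_mono mult_mono L2_vec_laplacian doubly V) auto
  finally have "L2_vec V L \<le> 2 * real h * a * L2_vec V y" by (simp add: algebra_simps)
  then have "(L2_vec V L)\<^sup>2 \<le> (2 * real h * a * L2_vec V y)\<^sup>2"
    by (intro power_mono) auto
  then have nL: "(L2_vec V L)\<^sup>2 \<le> 4 * (real h)\<^sup>2 * a\<^sup>2 * (L2_vec V y)\<^sup>2"
    by (simp add: power_mult_distrib)
  have inner: "2 * (\<Sum>i\<in>V. L i \<bullet> y i) = - (\<Sum>s<h. \<alpha> s * disagreement V (B s) y)"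
  proof -
    have "(\<Sum>i\<in>V. L i \<bullet> y i) = (\<Sum>s<h. \<alpha> s * (\<Sum>i\<in>V. laplacian V (B s) y i \<bullet> y i))"
      unfolding L_def inner_sum_left sum_distrib_left by (subst sum.swap) simp
    also have "\<dots> = (\<Sum>s<h. \<alpha> s * (- disagreement V (B s) y / 2))"
      by (intro sum.cong refl) (simp add: inner_laplacian[OF doubly])
    finally show ?thesis by (simp add: sum_distrib_left sum_negf[symmetric])
  qed
  have one: "\<kappa> * a * disagreement V (A r) y \<le> (\<Sum>s<h. \<alpha> s * disagreement V (B s) y)" if r: "r \<in> R" for r
  proof -
    obtain s where s: "s < h" "B s = A r" using visit[OF r] by auto
    have "\<kappa> * a * disagreement V (A r) y \<le> \<alpha> s * disagreement V (B s) y"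
      using \<kappa>(2)[OF s(1)] disagreement_nonneg[OF doubly[OF s(1)], of y] s by (auto intro: mult_right_mono)
    also have "\<dots> \<le> (\<Sum>s<h. \<alpha> s * disagreement V (B s) y)"
      using s gain disagreement_nonneg[OF doubly]
      by (intro member_le_sum[of s "{..<h}" "\<lambda>s. \<alpha> s * disagreement V (B s) y"]) (auto intro!: mult_nonneg_nonneg)
    finally show ?thesis .
  qed
  \<comment> \<open>The share of each graph is bounded by the whole block sum, so summing over
    \<open>R\<close> costs a factor \<open>card R\<close>. This avoids selecting different steps for
    different graphs.\<close>
  have "\<kappa> * a * (c * (L2_vec V y)\<^sup>2) \<le> (\<Sum>r\<in>R. \<kappa> * a * disagreement V (A r) y)"
    unfolding sum_distrib_left[symmetric] using c \<kappa> a by (intro mult_left_mono) auto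
  also have "\<dots> \<le> real (card R) * (\<Sum>s<h. \<alpha> s * disagreement V (B s) y)"
    using sum_bounded_above[of R "\<lambda>r. \<kappa> * a * disagreement V (A r) y", OF one] by simp
  finally have "b * (L2_vec V y)\<^sup>2 \<le> (\<Sum>s<h. \<alpha> s * disagreement V (B s) y)"
    using card by (simp add: b_def field_simps)
  then have "2 * (\<Sum>i\<in>V. L i \<bullet> y i) \<le> - (b * (L2_vec V y)\<^sup>2)"
    unfolding inner by simp
  moreover have "(L2_vec V (\<lambda>i. y i + L i))\<^sup>2
      = (L2_vec V y)\<^sup>2 + 2 * (\<Sum>i\<in>V. L i \<bullet> y i) + (L2_vec V L)\<^sup>2"
    unfolding L2_vec_power2 sum_distrib_left sum.distrib[symmetric]
    by (intro sum.cong refl) (simp add: power2_norm_eq_inner inner_add inner_commute)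
  ultimately have "(L2_vec V (\<lambda>i. y i + L i))\<^sup>2 \<le> (1 + 2 * (2 * (real h)\<^sup>2 * a\<^sup>2 - b / 2)) * (L2_vec V y)\<^sup>2"
    using nL by (simp add: algebra_simps)
  \<comment> \<open>Bernoulli's inequality \<open>1 + 2 * t \<le> (1 + t)\<^sup>2\<close> prepares
    the square root; the base is nonnegative because \<open>b \<le> 1\<close>.\<close>
  also have "\<dots> \<le> (1 + (2 * (real h)\<^sup>2 * a\<^sup>2 - b / 2))\<^sup>2 * (L2_vec V y)\<^sup>2"
    by (intro mult_right_mono) (auto simp: power2_sum)
  finally have "(L2_vec V (\<lambda>i. y i + L i))\<^sup>2 \<le> ((1 + (2 * (real h)\<^sup>2 * a\<^sup>2 - b / 2)) * L2_vec V y)\<^sup>2"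
    by (simp add: power_mult_distrib)
  moreover have "0 \<le> 1 + (2 * (real h)\<^sup>2 * a\<^sup>2 - b / 2)"
  proof -
    have "b \<le> 1" using a by (simp add: b_def)
    moreover have "0 \<le> 2 * (real h)\<^sup>2 * a\<^sup>2" by simp
    ultimately show ?thesis by linarith
  qed
  ultimately have "L2_vec V (\<lambda>i. y i + L i) \<le> (1 + (2 * (real h)\<^sup>2 * a\<^sup>2 - b / 2)) * L2_vec V y"
    by - (rule power2_le_imp_le, assumption, rule mult_nonneg_nonneg, assumption, simp)
  moreover have "1 + (2 * (real h)\<^sup>2 * a\<^sup>2 - b / 2)
      = 1 - c * \<kappa> / (2 * real (card R)) * a + 2 * (real h)\<^sup>2 * a\<^sup>2"
    by (simp add: b_def)
  ultimately show ?thesis unfolding L_def by simp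
qed

lemma perturbed_averaging_contraction:
  assumes R: "finite R" "R \<noteq> {}" and visit: "\<And>r. r \<in> R \<Longrightarrow> \<exists>s<h. B s = A r"
    and \<kappa>: "0 < \<kappa>" "\<And>s. s < h \<Longrightarrow> \<kappa> * a \<le> \<alpha> s"
    and a: "0 \<le> a" "c * \<kappa> / real (card R) * a \<le> 1"
    and c: "0 < c" "c * (L2_vec V (z 0))\<^sup>2 \<le> (\<Sum>r\<in>R. disagreement V (A r) (z 0))"
  shows "L2_vec V (z h) \<le> (1 - c * \<kappa> / (2 * real (card R)) * a + 6 * (real h)\<^sup>2 * a\<^sup>2) * L2_vec V (z 0)
      + (2 * (real h)\<^sup>2 * (2 * real h + 1) + real h) * \<epsilon>"
proof -
  let ?L = "\<lambda>s. laplacian V (B s)"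
  define Q where "Q i = z 0 i + (\<Sum>s<h. \<alpha> s *\<^sub>R ?L s (z 0) i)" for i
  \<comment> \<open>What separates a true step from a frozen one: the Laplacian of the drift, and
    the noise.\<close>
  define E where "E s i = \<alpha> s *\<^sub>R ?L s (\<lambda>i. z s i - z 0 i) i + p s i" for s i
  have E: "L2_vec V (E s) \<le> 2 * a * (real h * (2 * a * L2_vec V (z 0) + (2 * real h + 1) * \<epsilon>)) + \<epsilon>" if "s < h" for s
  proof -
    have "L2_vec V (E s) \<le> \<alpha> s * L2_vec V (?L s (\<lambda>i. z s i - z 0 i)) + L2_vec V (p s)"
      unfolding E_def using L2_vec_add[of V "\<lambda>i. \<alpha> s *\<^sub>R ?L s (\<lambda>i. z s i - z 0 i) i" "p s"] gain(1)[OF that]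
      by (simp add: L2_vec_scaleR)
    also have "\<dots> \<le> a * (2 * L2_vec V (\<lambda>i. z s i - z 0 i)) + \<epsilon>"
      by (intro add_mono mult_mono gain(2) noise(1) L2_vec_laplacian doubly V that a) auto
    also have "\<dots> \<le> a * (2 * (real h * (2 * a * L2_vec V (z 0) + (2 * real h + 1) * \<epsilon>))) + \<epsilon>"
      using that a perturbed_averaging_drift[of s] by (intro add_mono mult_left_mono) auto
    finally show ?thesis by (simp add: algebra_simps)
  qed
  have "L2_vec V (z h) = L2_vec V (\<lambda>i. Q i + (\<Sum>s<h. E s i))"
  proof (rule L2_vec_cong)
    fix i assume "i \<in> V"
    then have "z h i = z 0 i + (\<Sum>t<h. \<alpha> t *\<^sub>R ?L t (z t) i + p t i)"
      by (intro perturbed_averaging_sum) auto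
    also have "(\<Sum>t<h. \<alpha> t *\<^sub>R ?L t (z t) i + p t i) = (\<Sum>s<h. \<alpha> s *\<^sub>R ?L s (z 0) i + E s i)"
      by (intro sum.cong refl) (simp add: E_def laplacian_diff algebra_simps)
    finally show "z h i = Q i + (\<Sum>s<h. E s i)" by (simp add: Q_def sum.distrib)
  qed
  also have "\<dots> \<le> L2_vec V Q + (\<Sum>s<h. L2_vec V (E s))"
    using L2_vec_add[of V Q "\<lambda>i. \<Sum>s<h. E s i"] L2_vec_sum[of V E "{..<h}"] by simp
  also have "\<dots> \<le> (1 - c * \<kappa> / (2 * real (card R)) * a + 2 * (real h)\<^sup>2 * a\<^sup>2) * L2_vec V (z 0)
      + (\<Sum>s<h. 2 * a * (real h * (2 * a * L2_vec V (z 0) + (2 * real h + 1) * \<epsilon>)) + \<epsilon>)"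
    unfolding Q_def using assms E by (intro add_mono sum_mono frozen_averaging_contraction) auto
  also have "\<dots> = (1 - c * \<kappa> / (2 * real (card R)) * a + 6 * (real h)\<^sup>2 * a\<^sup>2) * L2_vec V (z 0)
      + a * (2 * (real h)\<^sup>2 * (2 * real h + 1) * \<epsilon>) + real h * \<epsilon>"
    by (simp add: algebra_simps power2_eq_square)
  also have "\<dots> \<le> (1 - c * \<kappa> / (2 * real (card R)) * a + 6 * (real h)\<^sup>2 * a\<^sup>2) * L2_vec V (z 0)
      + 1 * (2 * (real h)\<^sup>2 * (2 * real h + 1) * \<epsilon>) + real h * \<epsilon>"
    using gain(3) noise(2) by (intro add_mono order_refl mult_right_mono) auto
  finally show ?thesis by (simp add: algebra_simps)
qed

end

subsection \<open>Markov chains visiting all states\<close>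

text \<open>
  The initial state counts as visited, so that a block of times may start at the last time
  of the history on which one conditions.
\<close>

fun cover_prob :: "'s set \<Rightarrow> ('s \<Rightarrow> 's \<Rightarrow> real) \<Rightarrow> nat \<Rightarrow> 's set \<Rightarrow> 's \<Rightarrow> real" where
  "cover_prob S P 0 T i = (if T \<subseteq> {i} then 1 else 0)"
| "cover_prob S P (Suc n) T i = (\<Sum>j\<in>S. P i j * cover_prob S P n (T - {i}) j)"

context
  fixes S :: "'s set" and P :: "'s \<Rightarrow> 's \<Rightarrow> real"
  assumes row: "row_stochastic S P" and fin: "finite S"
begin

lemma stochastic_nonneg: "i \<in> S \<Longrightarrow> j \<in> S \<Longrightarrow> 0 \<le> P i j"
  and stochastic_sum: "i \<in> S \<Longrightarrow> (\<Sum>j\<in>S. P i j) = 1"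
  using row by (auto simp: row_stochastic_def)

lemma cover_prob_nonneg: "i \<in> S \<Longrightarrow> 0 \<le> cover_prob S P n T i"
  by (induction n arbitrary: T i) (auto intro!: sum_nonneg mult_nonneg_nonneg stochastic_nonneg)

lemma cover_prob_antimono: "i \<in> S \<Longrightarrow> T \<subseteq> T' \<Longrightarrow> cover_prob S P n T' i \<le> cover_prob S P n T i"
proof (induction n arbitrary: T T' i)
  case (Suc n)
  then show ?case
    by (auto intro!: sum_mono mult_left_mono Suc.IH stochastic_nonneg)
qed auto

lemma cover_prob_le_Suc: "i \<in> S \<Longrightarrow> cover_prob S P n T i \<le> cover_prob S P (Suc n) T i"
proof (induction n arbitrary: T i)
  case 0
  show ?case
  proof (cases "T \<subseteq> {i}")
    case True
    then have "T - {i} \<subseteq> {j}" for j by auto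
    then show ?thesis using 0 by (simp add: stochastic_sum)
  qed (use 0 in \<open>auto intro!: sum_nonneg mult_nonneg_nonneg stochastic_nonneg\<close>)
next
  case (Suc n)
  have "(\<Sum>j\<in>S. P i j * cover_prob S P n (T - {i}) j) \<le> (\<Sum>j\<in>S. P i j * cover_prob S P (Suc n) (T - {i}) j)"
    by (intro sum_mono mult_left_mono Suc.IH stochastic_nonneg Suc.prems)
  then show ?case by (simp only: cover_prob.simps)
qed

lemma cover_prob_mono: "i \<in> S \<Longrightarrow> n \<le> n' \<Longrightarrow> cover_prob S P n T i \<le> cover_prob S P n' T i"
  using lift_Suc_mono_le[of "\<lambda>n. cover_prob S P n T i", OF cover_prob_le_Suc] by blast

lemma cover_prob_insert: "cover_prob S P n (insert i T) i = cover_prob S P n T i"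
  by (cases n) auto

lemma transition_prob_nonneg: "j \<in> S \<Longrightarrow> 0 \<le> transition_prob S P n i j"
  by (induction n arbitrary: j) (auto intro!: sum_nonneg mult_nonneg_nonneg stochastic_nonneg)

text \<open>A positive entry of a power of \<open>P\<close> contains a positive product, hence a
  path of positive transitions; \<open>cover_prob_pos\<close> inducts along such a path.\<close>

lemma transition_prob_imp_rtrancl:
  "0 < transition_prob S P n i j \<Longrightarrow> i \<in> S \<Longrightarrow> j \<in> S \<Longrightarrow> (i, j) \<in> {(i, j). i \<in> S \<and> j \<in> S \<and> 0 < P i j}\<^sup>*"
proof (induction n arbitrary: j)
  case 0
  then show ?case by (auto split: if_splits)
next
  case (Suc n)
  obtain l where l: "l \<in> S" "0 < transition_prob S P n i l * P l j"
    using Suc.prems(1) sum_nonpos[of S "\<lambda>l. transition_prob S P n i l * P l j"] by (fastforce simp: not_le[symmetric])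
  have "0 < transition_prob S P n i l" "0 < P l j"
    using l transition_prob_nonneg[OF l(1), of n i] stochastic_nonneg[OF l(1) Suc.prems(3)]
    by (auto simp: zero_less_mult_iff)
  then show ?case
    using Suc.IH[of l] Suc.prems l by (auto intro: rtrancl_into_rtrancl)
qed

text \<open>Induction on the set of targets. A start at the new target \<open>t\<close> has visited
  it already, so covering the others from \<open>t\<close> suffices; then transitions are prepended
  one by one along a path from \<open>i\<close> to \<open>t\<close>, each keeping the probability
  positive.\<close>

lemma cover_prob_pos:
  assumes "irreducible_transitions S P" "T \<subseteq> S" "i \<in> S"
  shows "\<exists>n. 0 < cover_prob S P n T i"
proof -
  have "finite T" using assms fin finite_subset by blast
  then show ?thesis using assms(2,3)
  proof (induction T arbitrary: i)
    case empty
    show ?case by (intro exI[of _ 0]) simp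
  next
    case (insert t T)
    then obtain n where "0 < cover_prob S P n T t" by blast
    then have t: "\<exists>n. 0 < cover_prob S P n (insert t T) t"
      by (auto simp: cover_prob_insert)
    obtain k where "0 < transition_prob S P k i t"
      using assms(1) insert.prems unfolding irreducible_transitions_def by blast
    then have "(i, t) \<in> {(i, j). i \<in> S \<and> j \<in> S \<and> 0 < P i j}\<^sup>*"
      using transition_prob_imp_rtrancl insert.prems by auto
    then show ?case
    proof (induction rule: converse_rtrancl_induct)
      case base
      show ?case by (rule t)
    next
      case (step i j)
      then obtain n where n: "0 < cover_prob S P n (insert t T) j" by auto
      have ij: "i \<in> S" "j \<in> S" "0 < P i j" using step by auto
      have "0 < P i j * cover_prob S P n (insert t T - {i}) j"
        using ij n cover_prob_antimono[of j "insert t T - {i}" "insert t T" n] by auto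
      also have "\<dots> \<le> (\<Sum>j\<in>S. P i j * cover_prob S P n (insert t T - {i}) j)"
        using ij fin by (intro member_le_sum) (auto intro!: mult_nonneg_nonneg stochastic_nonneg cover_prob_nonneg)
      finally show ?case by (intro exI[of _ "Suc n"]) simp
    qed
  qed
qed

lemma cover_prob_uniform:
  assumes "irreducible_transitions S P"
  obtains n p where "0 < p" "\<And>i. i \<in> S \<Longrightarrow> p \<le> cover_prob S P n S i"
proof -
  obtain n where n: "\<And>i. i \<in> S \<Longrightarrow> 0 < cover_prob S P (n i) S i"
    using cover_prob_pos[OF assms order_refl] by metis
  \<comment> \<open>The sum of the horizons dominates each of them, and covering becomes only more
    likely with a longer horizon.\<close>
  define m where "m = (\<Sum>i\<in>S. n i)"
  \<comment> \<open>Inserting 1 makes the set nonempty, so that \<open>Min\<close> is meaningful for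
    every \<open>S\<close>.\<close>
  define p where "p = Min (insert 1 (cover_prob S P m S ` S))"
  have "0 < cover_prob S P m S i" if "i \<in> S" for i
    using n[OF that] cover_prob_mono[OF that, of "n i" m S] member_le_sum[of i S n] that fin
    by (auto simp: m_def)
  then have "0 < p" unfolding p_def using fin by (subst Min_gr_iff) auto
  moreover have "p \<le> cover_prob S P m S i" if "i \<in> S" for i
    unfolding p_def using fin that by (intro Min_le) auto
  ultimately show thesis using that by blast
qed

end

context prob_space
begin

definition history_event :: "(nat \<Rightarrow> 'a \<Rightarrow> 's) \<Rightarrow> nat \<Rightarrow> (nat \<Rightarrow> 's) \<Rightarrow> 'a set" where
  "history_event X k s = {\<omega> \<in> space M. \<forall>t\<le>k. X t \<omega> = s t}"

definition cover_event :: "(nat \<Rightarrow> 'a \<Rightarrow> 's) \<Rightarrow> nat \<Rightarrow> nat \<Rightarrow> 's set \<Rightarrow> 'a set" where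
  "cover_event X k n T = {\<omega> \<in> space M. T \<subseteq> (\<lambda>t. X t \<omega>) ` {k..k + n}}"

context
  fixes S :: "'s set" and P :: "'s \<Rightarrow> 's \<Rightarrow> real" and X :: "nat \<Rightarrow> 'a \<Rightarrow> 's"
  assumes chain: "markov_chain M S P X" and fin: "finite S"
begin

lemma markov_chain_row: "row_stochastic S P"
  using chain by (simp add: markov_chain_def)

lemma markov_chain_measurable [measurable]: "X k \<in> M \<rightarrow>\<^sub>M count_space UNIV"
proof -
  have "X k \<in> M \<rightarrow>\<^sub>M count_space S" using chain by (simp add: markov_chain_def)
  moreover have "(\<lambda>x. x) \<in> count_space S \<rightarrow>\<^sub>M count_space UNIV" by simp
  ultimately show ?thesis by (rule measurable_compose)
qed

lemma markov_chain_space: "\<omega> \<in> space M \<Longrightarrow> X k \<omega> \<in> S"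
  using chain measurable_space[of "X k" M "count_space S"] by (simp add: markov_chain_def)

lemma history_event_sets [measurable]: "history_event X k s \<in> events"
  unfolding history_event_def by measurable

lemma cover_event_sets [measurable]:
  assumes "T \<subseteq> S"
  shows "cover_event X k n T \<in> events"
proof -
  have "finite T" using assms fin finite_subset by blast
  moreover have "cover_event X k n T = {\<omega> \<in> space M. \<forall>r\<in>T. \<exists>t\<in>{k..k + n}. X t \<omega> = r}"
    by (auto simp: cover_event_def)
  ultimately show ?thesis by simp
qed

text \<open>The product rule for conditional probabilities. The Markov condition is silent about
  null histories, but for these both sides are 0.\<close>

lemma prob_history_Suc:
  assumes "j \<in> S"
  shows "prob (history_event X (Suc k) (s(Suc k := j))) = prob (history_event X k s) * P (s k) j"
proof -
  have eq: "history_event X (Suc k) (s(Suc k := j)) = {\<omega> \<in> space M. X (Suc k) \<omega> = j \<and> (\<forall>t\<le>k. X t \<omega> = s t)}"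
    unfolding history_event_def by (auto simp: le_Suc_eq)
  show ?thesis
  proof (cases "prob (history_event X k s) > 0")
    case True
    then have "\<P>(\<omega> in M. X (Suc k) \<omega> = j \<bar> \<forall>t\<le>k. X t \<omega> = s t) = P (s k) j"
      using chain assms by (auto simp: markov_chain_def history_event_def)
    then show ?thesis
      using True unfolding eq by (simp add: cond_prob_def history_event_def field_simps)
  next
    case False
    then have "prob (history_event X k s) = 0" by (simp add: not_less measure_le_0_iff)
    moreover have "prob (history_event X (Suc k) (s(Suc k := j))) \<le> prob (history_event X k s)"
      by (intro finite_measure_mono) (auto simp: eq history_event_def[of X k s])
    ultimately show ?thesis by (simp add: measure_le_0_iff)
  qed
qed

text \<open>Split by the state at time \<open>Suc k\<close>: every piece is again a history
  intersected with a cover event, from which the state \<open>s k\<close> has been removed as a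
  target. This matches the recursion of \<open>cover_prob\<close>.\<close>

lemma prob_history_cover:
  "T \<subseteq> S \<Longrightarrow> prob (history_event X k s \<inter> cover_event X k n T) = prob (history_event X k s) * cover_prob S P n T (s k)"
proof (induction n arbitrary: k s T)
  case 0
  have "history_event X k s \<inter> cover_event X k 0 T = (if T \<subseteq> {s k} then history_event X k s else {})"
    by (auto simp: history_event_def cover_event_def)
  then show ?case by simp
next
  case (Suc n)
  let ?E = "\<lambda>j. history_event X (Suc k) (s(Suc k := j)) \<inter> cover_event X (Suc k) n (T - {s k})"
  have int: "{k..k + Suc n} = insert k {Suc k..Suc k + n}" by auto
  have "\<omega> \<in> history_event X k s \<inter> cover_event X k (Suc n) T \<longleftrightarrow> (\<exists>j\<in>S. \<omega> \<in> ?E j)" for \<omega>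
  proof (cases "\<omega> \<in> history_event X k s")
    case True
    then have *: "\<omega> \<in> space M" "X k \<omega> = s k" "\<forall>t\<le>k. X t \<omega> = s t" by (auto simp: history_event_def)
    then have "\<omega> \<in> history_event X (Suc k) (s(Suc k := j)) \<longleftrightarrow> X (Suc k) \<omega> = j" for j
      by (auto simp: history_event_def le_Suc_eq)
    moreover have "\<omega> \<in> cover_event X k (Suc n) T \<longleftrightarrow> \<omega> \<in> cover_event X (Suc k) n (T - {s k})"
      unfolding cover_event_def int image_insert using * by auto
    ultimately show ?thesis using True markov_chain_space[OF *(1), of "Suc k"] by auto
  qed (auto simp: history_event_def le_Suc_eq)
  then have eq: "history_event X k s \<inter> cover_event X k (Suc n) T = (\<Union>j\<in>S. ?E j)"
    by blast
  have "prob (\<Union>j\<in>S. ?E j) = (\<Sum>j\<in>S. prob (?E j))"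
  proof (rule finite_measure_finite_Union[OF fin])
    show "?E ` S \<subseteq> events" using Suc.prems by (auto intro!: sets.Int cover_event_sets)
    show "disjoint_family_on ?E S"
      unfolding disjoint_family_on_def history_event_def by fastforce
  qed
  also have "\<dots> = (\<Sum>j\<in>S. prob (history_event X k s) * P (s k) j * cover_prob S P n (T - {s k}) j)"
    using Suc.prems by (intro sum.cong refl) (subst Suc.IH, auto simp: prob_history_Suc)
  finally show ?case unfolding eq by (simp add: sum_distrib_left mult.assoc)
qed

text \<open>A function of a finite history on a finite state space is a finite combination of
  indicators of histories. This yields its integrability and reduces the inequality to
  \<open>prob_history_cover\<close> on each history, without conditional expectations.\<close>

lemma expectation_cover:
  fixes F :: "'a \<Rightarrow> real"
  assumes F: "\<And>\<omega> \<omega>'. \<omega> \<in> space M \<Longrightarrow> \<omega>' \<in> space M \<Longrightarrow> (\<And>t. t \<le> k \<Longrightarrow> X t \<omega> = X t \<omega>') \<Longrightarrow> F \<omega> = F \<omega>'"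
    and F_nonneg: "\<And>\<omega>. \<omega> \<in> space M \<Longrightarrow> 0 \<le> F \<omega>"
    and p: "\<And>i. i \<in> S \<Longrightarrow> p \<le> cover_prob S P n S i"
  shows "integrable M F" "integrable M (\<lambda>\<omega>. indicator (cover_event X k n S) \<omega> * F \<omega>)"
    "p * expectation F \<le> expectation (\<lambda>\<omega>. indicator (cover_event X k n S) \<omega> * F \<omega>)"
proof -
  define H where "H = ({..k} \<rightarrow>\<^sub>E S)"
  \<comment> \<open>The constant value of \<open>F\<close> on the history \<open>s\<close>; the
    default 0 on an empty history event keeps \<open>v\<close> nonnegative.\<close>
  define v where "v s = (if history_event X k s = {} then 0 else F (SOME \<omega>. \<omega> \<in> history_event X k s))" for s
  have H: "finite H" unfolding H_def by (intro finite_PiE fin) auto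
  have v: "v s = F \<omega>" if "\<omega> \<in> history_event X k s" for s \<omega>
  proof -
    have "(SOME \<omega>. \<omega> \<in> history_event X k s) \<in> history_event X k s" using that by (rule someI)
    then show ?thesis using that unfolding v_def history_event_def by (auto intro!: F)
  qed
  have v_nonneg: "0 \<le> v s" for s
  proof (cases "history_event X k s = {}")
    case False
    then obtain \<omega> where w: "\<omega> \<in> history_event X k s" by auto
    then have "\<omega> \<in> space M" by (simp add: history_event_def)
    then show ?thesis using v[OF w] F_nonneg by simp
  qed (simp add: v_def)
  have F_eq: "F \<omega> = (\<Sum>s\<in>H. v s * indicator (history_event X k s) \<omega>)" if "\<omega> \<in> space M" for \<omega>
  proof -
    define s0 where "s0 = restrict (\<lambda>t. X t \<omega>) {..k}"
    have s0: "s0 \<in> H" unfolding s0_def H_def using markov_chain_space[OF that] by auto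
    have "\<omega> \<in> history_event X k s \<longleftrightarrow> s = s0" if "s \<in> H" for s
    proof
      assume "\<omega> \<in> history_event X k s"
      then show "s = s0" using that s0 unfolding H_def
        by (intro PiE_ext[of s _ _ s0]) (auto simp: s0_def history_event_def)
    qed (use \<open>\<omega> \<in> space M\<close> in \<open>auto simp: history_event_def s0_def\<close>)
    then have "(\<Sum>s\<in>H. v s * indicator (history_event X k s) \<omega>) = (\<Sum>s\<in>H. if s = s0 then v s else 0)"
      by (intro sum.cong refl) (auto simp: indicator_def)
    also have "\<dots> = v s0" using H s0 by simp
    also have "\<dots> = F \<omega>" by (rule v) (use that in \<open>auto simp: history_event_def s0_def\<close>)
    finally show ?thesis by simp
  qed
  have IF_eq: "indicator (cover_event X k n S) \<omega> * F \<omega>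
      = (\<Sum>s\<in>H. v s * indicator (history_event X k s \<inter> cover_event X k n S) \<omega>)" if "\<omega> \<in> space M" for \<omega>
    unfolding F_eq[OF that] sum_distrib_left by (intro sum.cong refl) (auto simp: indicator_def)
  have ev: "history_event X k s \<inter> cover_event X k n S \<in> events" for s by simp
  have int: "integrable M (\<lambda>\<omega>. v s * indicator (history_event X k s) \<omega> :: real)"
    "integrable M (\<lambda>\<omega>. v s * indicator (history_event X k s \<inter> cover_event X k n S) \<omega> :: real)" for s
    using ev by (auto intro!: integrable_mult_right simp: emeasure_eq_measure)
  show "integrable M F"
    by (subst Bochner_Integration.integrable_cong[OF refl F_eq]) (use int in auto)
  show "integrable M (\<lambda>\<omega>. indicator (cover_event X k n S) \<omega> * F \<omega>)"
    by (subst Bochner_Integration.integrable_cong[OF refl IF_eq]) (use int in auto)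
  have "expectation F = (\<Sum>s\<in>H. v s * prob (history_event X k s))"
    by (subst Bochner_Integration.integral_cong[OF refl F_eq], assumption,
        subst Bochner_Integration.integral_sum) (use int in auto)
  moreover have "expectation (\<lambda>\<omega>. indicator (cover_event X k n S) \<omega> * F \<omega>)
      = (\<Sum>s\<in>H. v s * (prob (history_event X k s) * cover_prob S P n S (s k)))"
    by (subst Bochner_Integration.integral_cong[OF refl IF_eq], assumption,
        subst Bochner_Integration.integral_sum)
       (use int ev in \<open>auto simp: prob_history_cover\<close>)
  moreover have "p * (\<Sum>s\<in>H. v s * prob (history_event X k s))
      \<le> (\<Sum>s\<in>H. v s * (prob (history_event X k s) * cover_prob S P n S (s k)))"
    unfolding sum_distrib_left
  proof (rule sum_mono)
    fix s assume "s \<in> H"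
    then have "s k \<in> S" by (auto simp: H_def)
    then have "(v s * prob (history_event X k s)) * p \<le> (v s * prob (history_event X k s)) * cover_prob S P n S (s k)"
      using p v_nonneg by (intro mult_left_mono) auto
    then show "p * (v s * prob (history_event X k s)) \<le> v s * (prob (history_event X k s) * cover_prob S P n S (s k))"
      by (simp add: mult_ac)
  qed
  ultimately show "p * expectation F \<le> expectation (\<lambda>\<omega>. indicator (cover_event X k n S) \<omega> * F \<omega>)"
    by simp
qed

text \<open>
  With \<open>y b\<close> the expectation of \<open>Y b\<close>, the recursion gives
  \<open>p * u b * y b \<le> y b - y (Suc b) + e b\<close>; multiplied by the decreasing \<open>w b\<close> the right-hand
  side telescopes.
\<close>

lemma AE_summable_contractions:
  fixes Y :: "nat \<Rightarrow> 'a \<Rightarrow> real" and u e w :: "nat \<Rightarrow> real" and K :: "nat \<Rightarrow> nat"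
  assumes p: "0 < p" "\<And>i. i \<in> S \<Longrightarrow> p \<le> cover_prob S P n S i"
    and K: "\<And>b. K b + n \<le> K (Suc b)"
    and Y0: "\<And>\<omega>. Y 0 \<omega> = y0" "0 \<le> y0"
    and Y: "\<And>b \<omega>. Y (Suc b) \<omega> = (1 - u b * indicator (cover_event X (K b) n S) \<omega>) * Y b \<omega> + e b"
    and u: "\<And>b. 0 \<le> u b" "\<And>b. u b \<le> 1" and e: "\<And>b. 0 \<le> e b"
    and w: "\<And>b. 0 \<le> w b" "decseq w" and we: "summable (\<lambda>b. w b * e b)"
  shows "AE \<omega> in M. summable (\<lambda>b. w b * u b * Y b \<omega>)"
proof -
  have nonneg: "0 \<le> Y b \<omega>" for b \<omega>
  proof (induction b)
    case (Suc b)
    have "0 \<le> 1 - u b * indicator (cover_event X (K b) n S) \<omega>"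
      using u[of b] by (auto simp: indicator_def)
    with Suc show ?case unfolding Y using e[of b] by (intro add_nonneg_nonneg mult_nonneg_nonneg)
  qed (use Y0 in simp)
  \<comment> \<open>\<open>Y b\<close> is determined by the chain up to time \<open>K b\<close>,
    because all earlier blocks have ended by then. A block may start at the last time of its
    predecessor.\<close>
  have hist: "Y b \<omega> = Y b \<omega>'"
    if "\<omega> \<in> space M" "\<omega>' \<in> space M" "\<And>t. t \<le> K b \<Longrightarrow> X t \<omega> = X t \<omega>'" for b \<omega> \<omega>'
    using that(3)
  proof (induction b)
    case (Suc b)
    have eq: "X t \<omega> = X t \<omega>'" if "t \<le> K b + n" for t
      using Suc.prems[of t] K[of b] that by simp
    then have "(\<lambda>t. X t \<omega>) ` {K b..K b + n} = (\<lambda>t. X t \<omega>') ` {K b..K b + n}"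
      by (intro image_cong) auto
    then have "indicator (cover_event X (K b) n S) \<omega> = (indicator (cover_event X (K b) n S) \<omega>' :: real)"
      using that by (auto simp: cover_event_def indicator_def)
    moreover have "Y b \<omega> = Y b \<omega>'" using eq by (intro Suc.IH) auto
    ultimately show ?case unfolding Y by simp
  qed (simp add: Y0)
  define y where "y b = expectation (Y b)" for b
  define c where "c b = expectation (\<lambda>\<omega>. indicator (cover_event X (K b) n S) \<omega> * Y b \<omega>)" for b
  have cover: "integrable M (Y b)"
    "integrable M (\<lambda>\<omega>. indicator (cover_event X (K b) n S) \<omega> * Y b \<omega>)"
    "p * expectation (Y b) \<le> expectation (\<lambda>\<omega>. indicator (cover_event X (K b) n S) \<omega> * Y b \<omega>)" for b
    by (rule expectation_cover[of "K b" "Y b" p n], (rule hist; blast), rule nonneg, erule p(2))+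
  have y_nonneg: "0 \<le> y b" for b unfolding y_def using nonneg by (intro Bochner_Integration.integral_nonneg) auto
  have y_Suc: "y (Suc b) \<le> y b - p * u b * y b + e b" for b
  proof -
    have "Y (Suc b) = (\<lambda>\<omega>. Y b \<omega> - u b * (indicator (cover_event X (K b) n S) \<omega> * Y b \<omega>) + e b)"
      by (rule ext) (simp add: Y algebra_simps)
    then have "y (Suc b) = y b - u b * c b + e b"
      using cover(1,2)[of b] by (simp add: y_def c_def prob_space)
    moreover have "u b * (p * y b) \<le> u b * c b"
      using cover(3)[of b] u unfolding y_def c_def by (intro mult_left_mono) auto
    ultimately show ?thesis by (simp add: algebra_simps)
  qed
  have partial: "(\<Sum>b<N. p * (w b * u b * y b)) + w N * y N \<le> w 0 * y 0 + (\<Sum>b<N. w b * e b)" for N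
  proof (induction N)
    case (Suc N)
    have "w (Suc N) * y (Suc N) \<le> w N * y (Suc N)"
      using w(2) y_nonneg by (intro mult_right_mono) (auto simp: decseq_Suc_iff)
    also have "\<dots> \<le> w N * (y N - p * u N * y N + e N)"
      using w y_Suc by (intro mult_left_mono) auto
    finally show ?case using Suc by (simp add: algebra_simps)
  qed simp
  have "summable (\<lambda>b. p * (w b * u b * y b))"
  proof (rule summableI_nonneg_bounded)
    fix N
    have "(\<Sum>b<N. w b * e b) \<le> (\<Sum>b. w b * e b)"
      using we w e by (intro sum_le_suminf) auto
    then show "(\<Sum>b<N. p * (w b * u b * y b)) \<le> w 0 * y 0 + (\<Sum>b. w b * e b)"
      using partial[of N] mult_nonneg_nonneg[OF w(1) y_nonneg, of N N] by linarith
  qed (use p w u y_nonneg in auto)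
  then have sum_y: "summable (\<lambda>b. w b * u b * y b)"
    using summable_mult[of "\<lambda>b. p * (w b * u b * y b)" "1 / p"] p by simp
  have meas: "Y b \<in> borel_measurable M" for b using cover(1)[of b] by auto
  \<comment> \<open>By Tonelli the series has finite expectation, so it is finite almost
    surely.\<close>
  have "(\<integral>\<^sup>+\<omega>. (\<Sum>b. ennreal (w b * u b * Y b \<omega>)) \<partial>M) = (\<Sum>b. \<integral>\<^sup>+\<omega>. ennreal (w b * u b * Y b \<omega>) \<partial>M)"
    using meas by (intro nn_integral_suminf) auto
  also have "\<dots> = (\<Sum>b. ennreal (w b * u b * y b))"
  proof (intro suminf_cong)
    fix b
    have "integrable M (\<lambda>\<omega>. w b * u b * Y b \<omega>)" using cover(1)[of b] by auto
    then show "(\<integral>\<^sup>+\<omega>. ennreal (w b * u b * Y b \<omega>) \<partial>M) = ennreal (w b * u b * y b)"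
      using w u nonneg by (subst nn_integral_eq_integral) (auto simp: y_def)
  qed
  also have "\<dots> = ennreal (\<Sum>b. w b * u b * y b)"
    using sum_y w u y_nonneg by (intro suminf_ennreal2) auto
  finally have "(\<integral>\<^sup>+\<omega>. (\<Sum>b. ennreal (w b * u b * Y b \<omega>)) \<partial>M) \<noteq> \<infinity>" by simp
  then have "AE \<omega> in M. (\<Sum>b. ennreal (w b * u b * Y b \<omega>)) \<noteq> \<infinity>"
    using meas by (intro nn_integral_noteq_infinite) auto
  then show ?thesis
    by eventually_elim (use w u nonneg in \<open>auto intro!: summable_suminf_not_top\<close>)
qed

end

end

subsection \<open>Convex functions and perturbed subgradient steps\<close>

text \<open>Separate the point \<open>(x, f x)\<close> from the strict epigraph. As \<open>f\<close>
  is finite everywhere, the hyperplane is not vertical; dividing by its vertical coefficient gives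
  the slope of an affine minorant.\<close>

lemma subdifferential_nonempty:
  fixes f :: "'a::euclidean_space \<Rightarrow> real"
  assumes "convex_on UNIV f"
  shows "subdifferential f x \<noteq> {}"
proof -
  define T where "T = {q :: 'a \<times> real. f (fst q) < snd q}"
  have "convex T"
  proof (rule convexI)
    fix q q' :: "'a \<times> real" and u v :: real
    assume *: "q \<in> T" "q' \<in> T" "0 \<le> u" "0 \<le> v" "u + v = 1"
    have "f (u *\<^sub>R fst q + v *\<^sub>R fst q') \<le> u * f (fst q) + v * f (fst q')"
      using assms * by (auto simp: convex_on_def)
    also have "\<dots> < u * snd q + v * snd q'"
    proof (cases "u = 0")
      case False
      then show ?thesis using * by (intro add_less_le_mono mult_strict_left_mono mult_left_mono) (auto simp: T_def)
    qed (use * in \<open>auto simp: T_def\<close>)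
    finally show "u *\<^sub>R q + v *\<^sub>R q' \<in> T" by (simp add: T_def)
  qed
  moreover have "(x, f x + 1) \<in> T" "{(x, f x)} \<inter> T = {}" by (auto simp: T_def)
  ultimately obtain a b where ab: "a \<noteq> 0" "\<And>q. q \<in> {(x, f x)} \<Longrightarrow> a \<bullet> q \<le> b" "\<And>q. q \<in> T \<Longrightarrow> b \<le> a \<bullet> q"
    using separating_hyperplane_sets[of "{(x, f x)}" T] by blast
  obtain g c where a: "a = (g, c)" by fastforce
  have sep: "g \<bullet> x + c * f x \<le> g \<bullet> y + c * t" if "f y < t" for y t
    using ab(2)[of "(x, f x)"] ab(3)[of "(y, t)"] that by (auto simp: a T_def)
  have "0 \<le> c" using sep[of x "f x + 1"] by (simp add: algebra_simps)
  moreover have "c \<noteq> 0"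
  proof
    assume c: "c = 0"
    \<comment> \<open>A vertical hyperplane is tested at \<open>x - g\<close>, which forces its
      horizontal normal to vanish.\<close>
    have "g \<bullet> g \<le> 0" using sep[of "x - g" "f (x - g) + 1"] by (simp add: c inner_diff_right)
    then have "g = 0" by (metis inner_gt_zero_iff not_le)
    then show False using ab(1) by (simp add: a c zero_prod_def)
  qed
  ultimately have c: "0 < c" by simp
  have "f x + (- (1 / c) *\<^sub>R g) \<bullet> (y - x) \<le> f y" for y
  \<comment> \<open>Separation is known only strictly above the graph, so \<open>f y\<close> is
    approached from above.\<close>
  proof (rule dense_ge)
    fix t assume "f y < t"
    from sep[OF this] have "c * (f x + (- (1 / c) *\<^sub>R g) \<bullet> (y - x)) \<le> c * t"
      using c by (simp add: algebra_simps inner_diff_right)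
    then show "f x + (- (1 / c) *\<^sub>R g) \<bullet> (y - x) \<le> t" using c by simp
  qed
  then show ?thesis unfolding subdifferential_def by blast
qed

text \<open>The affine minorant given by a subgradient at \<open>y\<close> limits the fall of
  \<open>f\<close> from \<open>y\<close> to \<open>z\<close>; exchanging the points gives the
  Lipschitz property.\<close>

lemma bounded_subdifferential_lipschitz:
  fixes f :: "'a::euclidean_space \<Rightarrow> real"
  assumes "convex_on UNIV f" and l: "\<And>y g. g \<in> subdifferential f y \<Longrightarrow> norm g \<le> l"
  shows "f y - f z \<le> l * norm (y - z)"
proof -
  obtain g where g: "g \<in> subdifferential f y" using subdifferential_nonempty[OF assms(1)] by blast
  then have "f y + g \<bullet> (z - y) \<le> f z" by (simp add: subdifferential_def)
  then have "f y - f z \<le> - (g \<bullet> (z - y))" by linarith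
  also have "\<dots> \<le> norm g * norm (z - y)" using Cauchy_Schwarz_ineq2[of g "z - y"] by linarith
  also have "\<dots> \<le> l * norm (z - y)" using l[OF g] by (intro mult_right_mono) auto
  finally show ?thesis by (simp add: norm_minus_commute)
qed

text \<open>A deterministic form of the Robbins-Siegmund lemma: subtracting the partial sums of the
  errors leaves a decreasing sequence that is bounded below.\<close>

lemma almost_decreasing_convergent:
  fixes v g e :: "nat \<Rightarrow> real"
  assumes step: "\<And>k. v (Suc k) \<le> v k - g k + e k"
    and nonneg: "\<And>k. 0 \<le> v k" "\<And>k. 0 \<le> g k" "\<And>k. 0 \<le> e k" and e: "summable e"
  shows "convergent v" "summable g"
proof -
  define u where "u k = v k - (\<Sum>j<k. e j)" for k
  have le: "(\<Sum>j<k. e j) \<le> suminf e" for k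
    using e nonneg by (intro sum_le_suminf) auto
  have "u (Suc k) \<le> u k" for k using step[of k] nonneg(2)[of k] by (simp add: u_def)
  then have "decseq u" by (simp add: decseq_Suc_iff)
  moreover have "- suminf e \<le> u k" for k unfolding u_def using le[of k] nonneg(1)[of k] by linarith
  ultimately have "convergent u" using decseq_convergent[of u] unfolding convergent_def by metis
  moreover have "convergent (\<lambda>k. \<Sum>j<k. e j)" using e by (simp add: summable_iff_convergent)
  ultimately have "convergent (\<lambda>k. u k + (\<Sum>j<k. e j))" by (rule convergent_add)
  then show "convergent v" by (simp add: u_def)
  have partial: "(\<Sum>j<n. g j) + v n \<le> v 0 + (\<Sum>j<n. e j)" for n
  proof (induction n)
    case (Suc n)
    then show ?case using step[of n] by simp
  qed simp
  have "(\<Sum>j<n. g j) \<le> v 0 + suminf e" for n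
    using partial[of n] le[of n] nonneg(1)[of n] by linarith
  then show "summable g" using nonneg by (intro summableI_nonneg_bounded) auto
qed

text \<open>If \<open>g\<close> stayed above \<open>\<epsilon>\<close>, then \<open>\<beta>\<close>
  would eventually be dominated by a multiple of a summable series.\<close>

lemma frequently_small_of_weighted_summable:
  fixes \<beta> g :: "nat \<Rightarrow> real"
  assumes \<beta>: "\<And>k. 0 \<le> \<beta> k" "\<not> summable \<beta>" and g: "summable (\<lambda>k. \<beta> k * g k)" and "0 < \<epsilon>"
  shows "\<exists>k\<ge>n. g k < \<epsilon>"
proof (rule ccontr)
  assume "\<not> (\<exists>k\<ge>n. g k < \<epsilon>)"
  then have ge: "\<epsilon> \<le> g k" if "k \<ge> n" for k using that by force
  have "summable \<beta>"
  proof (rule summable_comparison_test')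
    show "summable (\<lambda>k. \<beta> k * g k * (1 / \<epsilon>))" using g by (rule summable_mult2)
    show "norm (\<beta> k) \<le> \<beta> k * g k * (1 / \<epsilon>)" if "n \<le> k" for k
      using mult_left_mono[OF ge[OF that] \<beta>(1)[of k]] \<beta>(1)[of k] \<open>0 < \<epsilon>\<close> by (simp add: field_simps)
  qed
  with \<beta> show False by simp
qed

text \<open>
  The squares of \<open>y\<close> have summable increments \<open>2 * C * \<beta> k * y k + C\<^sup>2 * (\<beta> k)\<^sup>2\<close>, hence converge.
\<close>

lemma weighted_summable_tendsto_zero:
  fixes \<beta> y :: "nat \<Rightarrow> real"
  assumes \<beta>: "\<And>k. 0 \<le> \<beta> k" "\<not> summable \<beta>" "summable (\<lambda>k. (\<beta> k)\<^sup>2)"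
    and y: "\<And>k. 0 \<le> y k" "\<And>k. y (Suc k) \<le> y k + C * \<beta> k" "summable (\<lambda>k. \<beta> k * y k)" and C: "0 \<le> C"
  shows "y \<longlonglongrightarrow> 0"
proof -
  have "convergent (\<lambda>k. (y k)\<^sup>2)"
  proof (rule almost_decreasing_convergent(1))
    show "(y (Suc k))\<^sup>2 \<le> (y k)\<^sup>2 - 0 + (2 * C * (\<beta> k * y k) + C\<^sup>2 * (\<beta> k)\<^sup>2)" for k
      using power_mono[OF y(2) y(1), of k 2] by (simp add: power2_sum power_mult_distrib algebra_simps)
    show "summable (\<lambda>k. 2 * C * (\<beta> k * y k) + C\<^sup>2 * (\<beta> k)\<^sup>2)"
      by (intro summable_add summable_mult y \<beta>)
  qed (use \<beta> y C in auto)
  then obtain L where L: "(\<lambda>k. (y k)\<^sup>2) \<longlonglongrightarrow> L" by (auto simp: convergent_def)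
  \<comment> \<open>A positive limit is impossible: as \<open>\<beta>\<close> is not summable,
    \<open>y\<close> falls below every positive level at arbitrarily late times.\<close>
  have "L \<le> 0"
  proof (rule ccontr)
    assume "\<not> L \<le> 0"
    then have "\<forall>\<^sub>F k in sequentially. L / 2 < (y k)\<^sup>2"
      using order_tendstoD(1)[OF L, of "L / 2"] by simp
    then obtain n where n: "\<And>k. k \<ge> n \<Longrightarrow> L / 2 < (y k)\<^sup>2" by (auto simp: eventually_sequentially)
    obtain k where k: "k \<ge> n" "y k < sqrt (L / 2)"
      using frequently_small_of_weighted_summable[OF \<beta>(1,2) y(3), of "sqrt (L / 2)" n] \<open>\<not> L \<le> 0\<close> by auto
    have "(y k)\<^sup>2 \<le> L / 2"
      using power_mono[OF less_imp_le[OF k(2)] y(1), of 2] \<open>\<not> L \<le> 0\<close> by simp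
    with n[OF k(1)] show False by simp
  qed
  moreover have "0 \<le> L" by (rule LIMSEQ_le_const[OF L]) auto
  ultimately have "(\<lambda>k. sqrt ((y k)\<^sup>2)) \<longlonglongrightarrow> sqrt 0" using L by (intro tendsto_real_sqrt) simp
  then show ?thesis using y(1) by simp
qed

text \<open>Terms are nonnegative, so every partial sum is bounded by one over whole blocks. This
  transfers summability from block starts to all times.\<close>

lemma summable_of_blocks:
  fixes g G :: "nat \<Rightarrow> real"
  assumes "0 < h" "\<And>k. 0 \<le> g k" "\<And>b. (\<Sum>s<h. g (b * h + s)) \<le> G b" "summable G"
  shows "summable g"
proof (rule summableI_nonneg_bounded)
  have blk: "sum g {b * h..<b * h + h} = (\<Sum>s<h. g (b * h + s))" for b
    using sum.shift_bounds_nat_ivl[of g 0 "b * h" h] by (simp add: lessThan_atLeast0 add.commute)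
  have G: "0 \<le> G b" for b by (rule order_trans[OF _ assms(3)]) (use assms in \<open>auto intro: sum_nonneg\<close>)
  fix n
  have "n \<le> n * h" using assms by simp
  then have "(\<Sum>k<n. g k) \<le> (\<Sum>k<n * h. g k)"
    using assms by (intro sum_mono2) auto
  also have "\<dots> = (\<Sum>b<n. sum g {b * h..<b * h + h})" by (simp add: sum.nat_group)
  also have "\<dots> \<le> (\<Sum>b<n. G b)" unfolding blk by (intro sum_mono assms)
  also have "\<dots> \<le> suminf G" using assms G by (intro sum_le_suminf) auto
  finally show "(\<Sum>k<n. g k) \<le> suminf G" .
qed (rule assms)

text \<open>Expand the square. The subgradients belong to the points \<open>x i\<close>, not to
  \<open>q\<close>: replacing \<open>x i\<close> by \<open>q\<close> costs \<open>l * y\<close> once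
  in the function value and once in the inner product, hence the coefficient 4.\<close>

lemma subgradient_step:
  fixes f :: "'i \<Rightarrow> 'a::real_inner \<Rightarrow> real"
  assumes V: "finite V" "V \<noteq> {}" and \<beta>: "0 \<le> \<beta>" and l: "0 \<le> l"
    and lip: "\<And>i y z. i \<in> V \<Longrightarrow> f i y - f i z \<le> l * norm (y - z)"
    and sub: "\<And>i. i \<in> V \<Longrightarrow> d i \<in> subdifferential (f i) (x i)" "\<And>i. i \<in> V \<Longrightarrow> norm (d i) \<le> l"
    and y: "\<And>i. i \<in> V \<Longrightarrow> norm (x i - q) \<le> y"
  shows "(norm (q - (\<beta> / real (card V)) *\<^sub>R (\<Sum>i\<in>V. d i) - z))\<^sup>2
    \<le> (norm (q - z))\<^sup>2 - 2 / real (card V) * (\<beta> * ((\<Sum>i\<in>V. f i q) - (\<Sum>i\<in>V. f i z)))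
      + (4 * l * (\<beta> * y) + l\<^sup>2 * \<beta>\<^sup>2)"
proof -
  define N where "N = real (card V)"
  have N: "0 < N" using V by (simp add: N_def card_gt_0_iff)
  define D where "D = (\<Sum>i\<in>V. d i)"
  have "norm D \<le> (\<Sum>i\<in>V. l)" unfolding D_def by (rule order_trans[OF norm_sum]) (intro sum_mono sub)
  then have "norm D \<le> N * l" by (simp add: N_def)
  then have "norm ((\<beta> / N) *\<^sub>R D) \<le> \<beta> / N * (N * l)"
    using \<beta> N unfolding norm_scaleR by (intro mult_mono) auto
  then have nD: "(norm ((\<beta> / N) *\<^sub>R D))\<^sup>2 \<le> l\<^sup>2 * \<beta>\<^sup>2"
    using N power_mono[of "norm ((\<beta> / N) *\<^sub>R D)" "l * \<beta>" 2] by (simp add: power_mult_distrib mult.commute)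
  have "f i q - f i z - 2 * l * y \<le> d i \<bullet> (q - z)" if i: "i \<in> V" for i
  proof -
    have "f i (x i) + d i \<bullet> (z - x i) \<le> f i z"
      using sub(1)[OF i] by (simp add: subdifferential_def)
    then have "f i (x i) - f i z \<le> - (d i \<bullet> (z - x i))" by linarith
    moreover have "f i q - f i (x i) \<le> l * y"
      using lip[OF i, of q "x i"] mult_left_mono[OF y[OF i] l] by (simp add: norm_minus_commute)
    moreover have "d i \<bullet> (x i - q) \<le> l * y"
      by (rule order_trans[OF norm_cauchy_schwarz]) (intro mult_mono sub y i l norm_ge_zero)
    ultimately show ?thesis by (simp add: inner_diff_right)
  qed
  then have "(\<Sum>i\<in>V. f i q - f i z - 2 * l * y) \<le> (\<Sum>i\<in>V. d i \<bullet> (q - z))" by (rule sum_mono)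
  then have "(\<Sum>i\<in>V. f i q) - (\<Sum>i\<in>V. f i z) - N * (2 * l * y) \<le> D \<bullet> (q - z)"
    by (simp add: D_def inner_sum_left sum_subtractf N_def)
  then have "2 * (\<beta> / N) * ((\<Sum>i\<in>V. f i q) - (\<Sum>i\<in>V. f i z) - N * (2 * l * y)) \<le> 2 * (\<beta> / N) * (D \<bullet> (q - z))"
    using \<beta> N by (intro mult_left_mono) auto
  moreover have "2 * (\<beta> / N) * ((\<Sum>i\<in>V. f i q) - (\<Sum>i\<in>V. f i z) - N * (2 * l * y))
      = 2 / N * (\<beta> * ((\<Sum>i\<in>V. f i q) - (\<Sum>i\<in>V. f i z))) - 4 * l * (\<beta> * y)"
    using N by (simp add: field_simps)
  moreover have "(norm (q - (\<beta> / N) *\<^sub>R D - z))\<^sup>2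
      = (norm (q - z))\<^sup>2 - 2 * (\<beta> / N) * (D \<bullet> (q - z)) + (norm ((\<beta> / N) *\<^sub>R D))\<^sup>2"
  proof -
    have *: "(norm (w - e))\<^sup>2 = (norm w)\<^sup>2 - 2 * (e \<bullet> w) + (norm e)\<^sup>2" for w e :: 'a
      by (simp add: power2_norm_eq_inner inner_diff inner_commute)
    have "q - (\<beta> / N) *\<^sub>R D - z = (q - z) - (\<beta> / N) *\<^sub>R D" by simp
    then show ?thesis by (simp only: * inner_scaleR_left mult.assoc)
  qed
  ultimately show ?thesis using nD unfolding N_def D_def by linarith
qed

text \<open>A Fejer argument. Optimality gaps weighted by \<open>\<beta>\<close> are summable, so
  some subsequence has vanishing gaps; by compactness it can be refined to converge to a minimiser.
  The distance to that minimiser converges along the full sequence, and its limit, read off the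
  subsequence, is 0.\<close>

lemma subgradient_method_converges:
  fixes f :: "'i \<Rightarrow> 'a::euclidean_space \<Rightarrow> real" and q :: "nat \<Rightarrow> 'a"
  assumes V: "finite V" "V \<noteq> {}" and l: "0 \<le> l"
    and lip: "\<And>i y z. i \<in> V \<Longrightarrow> f i y - f i z \<le> l * norm (y - z)"
    and sub: "\<And>i k. i \<in> V \<Longrightarrow> d k i \<in> subdifferential (f i) (x k i)" "\<And>i k. i \<in> V \<Longrightarrow> norm (d k i) \<le> l"
    and q: "\<And>k. q (Suc k) = q k - (\<beta> k / real (card V)) *\<^sub>R (\<Sum>i\<in>V. d k i)"
    and y: "\<And>i k. i \<in> V \<Longrightarrow> norm (x k i - q k) \<le> y k" "summable (\<lambda>k. \<beta> k * y k)"
    and \<beta>: "\<And>k. 0 \<le> \<beta> k" "\<not> summable \<beta>" "summable (\<lambda>k. (\<beta> k)\<^sup>2)"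
    and opt: "\<And>z. (\<Sum>i\<in>V. f i z0) \<le> (\<Sum>i\<in>V. f i z)"
  shows "\<exists>zs. (\<forall>z. (\<Sum>i\<in>V. f i zs) \<le> (\<Sum>i\<in>V. f i z)) \<and> q \<longlonglongrightarrow> zs"
proof -
  define F where "F z = (\<Sum>i\<in>V. f i z)" for z
  define N where "N = real (card V)"
  have N: "0 < N" using V by (simp add: N_def card_gt_0_iff)
  have y_nonneg: "0 \<le> y k" for k using V y(1)[of _ k] norm_ge_zero order_trans by (metis ex_in_conv)
  have conv: "convergent (\<lambda>k. (norm (q k - z))\<^sup>2)" "summable (\<lambda>k. 2 / N * (\<beta> k * (F (q k) - F z)))"
    if z: "\<And>z'. F z \<le> F z'" for z
  proof -
    have step: "(norm (q (Suc k) - z))\<^sup>2 \<le> (norm (q k - z))\<^sup>2 - 2 / N * (\<beta> k * (F (q k) - F z))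
        + (4 * l * (\<beta> k * y k) + l\<^sup>2 * (\<beta> k)\<^sup>2)" for k
      unfolding q F_def N_def by (rule subgradient_step[OF V \<beta>(1) l lip sub y(1)])
    have "summable (\<lambda>k. 4 * l * (\<beta> k * y k) + l\<^sup>2 * (\<beta> k)\<^sup>2)"
      by (intro summable_add summable_mult y \<beta>)
    note * = almost_decreasing_convergent[OF step zero_le_power2 _ _ this]
    show "convergent (\<lambda>k. (norm (q k - z))\<^sup>2)" "summable (\<lambda>k. 2 / N * (\<beta> k * (F (q k) - F z)))"
      by (rule *; use N z \<beta> l y_nonneg in auto)+
  qed
  have opt': "F z0 \<le> F z" for z using opt by (simp add: F_def)
  have "summable (\<lambda>k. \<beta> k * (F (q k) - F z0))"
    using summable_mult[OF conv(2)[OF opt'], of "N / 2"] N by simp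
  then have "\<exists>k\<ge>n. F (q k) - F z0 < 1 / real (Suc n)" for n
    using frequently_small_of_weighted_summable[OF \<beta>(1,2)] by simp
  \<comment> \<open>\<open>\<tau>\<close> need not be increasing; \<open>n \<le> \<tau> n\<close> is
    enough for the refined indices to tend to infinity.\<close>
  then obtain \<tau> where \<tau>: "\<And>n. n \<le> \<tau> n" "\<And>n. F (q (\<tau> n)) - F z0 < 1 / real (Suc n)" by metis
  have "Bseq (\<lambda>k. (norm (q k - z0))\<^sup>2)" using conv(1)[OF opt'] by (rule convergent_imp_Bseq)
  then obtain B where B: "\<And>k. (norm (q k - z0))\<^sup>2 \<le> B" unfolding Bseq_def by fastforce
  have "norm (q k - z0) \<le> sqrt B" for k using B[of k] by (intro real_le_rsqrt) auto
  then have "\<forall>n. (q \<circ> \<tau>) n \<in> cball z0 (sqrt B)" by (auto simp: dist_norm norm_minus_commute)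
  then obtain zs r where r: "strict_mono r" "((q \<circ> \<tau>) \<circ> r) \<longlonglongrightarrow> zs"
    using compact_imp_seq_compact[OF compact_cball] unfolding seq_compact_def by metis
  define \<rho> where "\<rho> = \<tau> \<circ> r"
  have \<rho>_ge: "n \<le> \<rho> n" for n using \<tau>(1)[of "r n"] seq_suble[OF r(1), of n] by (simp add: \<rho>_def)
  then have \<rho>: "filterlim \<rho> sequentially sequentially"
    by (intro filterlim_at_top_mono[OF filterlim_ident]) auto
  have q\<rho>: "(\<lambda>n. q (\<rho> n)) \<longlonglongrightarrow> zs" using r(2) by (simp add: \<rho>_def o_def)
  have F_lip: "F z \<le> F z' + N * l * norm (z - z')" for z z'
  proof -
    have "(\<Sum>i\<in>V. f i z - f i z') \<le> (\<Sum>i\<in>V. l * norm (z - z'))" by (intro sum_mono lip)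
    then show ?thesis by (simp add: F_def N_def sum_subtractf)
  qed
  have "F zs \<le> F z0"
  proof (rule LIMSEQ_le_const)
    have "(\<lambda>n. F z0 + 1 / real (Suc (r n)) + N * l * norm (zs - q (\<rho> n))) \<longlonglongrightarrow> F z0 + 0 + N * l * norm (zs - zs)"
      using LIMSEQ_subseq_LIMSEQ[OF LIMSEQ_inverse_real_of_nat r(1)]
      by (intro tendsto_intros q\<rho>) (simp add: o_def inverse_eq_divide)
    then show "(\<lambda>n. F z0 + 1 / real (Suc (r n)) + N * l * norm (zs - q (\<rho> n))) \<longlonglongrightarrow> F z0" by simp
    have "F zs \<le> F z0 + 1 / real (Suc (r n)) + N * l * norm (zs - q (\<rho> n))" for n
      using F_lip[of zs "q (\<rho> n)"] \<tau>(2)[of "r n"] by (simp add: \<rho>_def)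
    then show "\<exists>n0. \<forall>n\<ge>n0. F zs \<le> F z0 + 1 / real (Suc (r n)) + N * l * norm (zs - q (\<rho> n))" by blast
  qed
  then have opt_zs: "F zs \<le> F z" for z using opt'[of z] by simp
  obtain L where L: "(\<lambda>k. (norm (q k - zs))\<^sup>2) \<longlonglongrightarrow> L" using conv(1)[OF opt_zs] by (auto simp: convergent_def)
  have "(\<lambda>n. (norm (q (\<rho> n) - zs))\<^sup>2) \<longlonglongrightarrow> L" using filterlim_compose[OF L \<rho>] by simp
  moreover have "(\<lambda>n. (norm (q (\<rho> n) - zs))\<^sup>2) \<longlonglongrightarrow> (norm (zs - zs))\<^sup>2" by (intro tendsto_intros q\<rho>)
  ultimately have "L = (norm (zs - zs))\<^sup>2" by (rule LIMSEQ_unique)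
  then have "L = 0" by simp
  then have "(\<lambda>k. sqrt ((norm (q k - zs))\<^sup>2)) \<longlonglongrightarrow> sqrt 0" using L by (intro tendsto_real_sqrt) simp
  then have "(\<lambda>k. norm (q k - zs)) \<longlonglongrightarrow> 0" by simp
  then have "(\<lambda>k. q k - zs) \<longlonglongrightarrow> 0" by (rule tendsto_norm_zero_cancel)
  then have "q \<longlonglongrightarrow> zs" by (rule LIM_zero_cancel)
  with opt_zs[unfolded F_def] show ?thesis by (intro exI[of _ zs] conjI allI)
qed

lemma summable_shifted_powr_iff: "summable (\<lambda>k. (real k + 1) powr s) \<longleftrightarrow> s < -1"
  using summable_iff_shift[of "\<lambda>n. real n powr s" 1] summable_real_powr_iff[of s] by (simp add: add.commute)

subsection \<open>Consensus and convergence\<close>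

text \<open>
  The noise may depend on the whole path of the chain, so the Markov property cannot be applied
  to \<open>\<eta>\<close> itself. It is applied to a scalar majorant \<open>Y\<close> of the error at the ends of the
  blocks, which is driven only by the events that a block visits all states.
\<close>

lemma (in prob_space) AE_consensus:
  fixes A :: "'s \<Rightarrow> 'v \<Rightarrow> 'v \<Rightarrow> real" and \<theta> :: "nat \<Rightarrow> 'a \<Rightarrow> 's"
    and \<eta> \<xi> :: "nat \<Rightarrow> 'a \<Rightarrow> 'v \<Rightarrow> 'b::real_inner"
  assumes V: "finite V" "V \<noteq> {}" and S: "finite S"
    and chain: "markov_chain M S P \<theta>" and irred: "irreducible_transitions S P"
    and doubly: "\<And>r. r \<in> S \<Longrightarrow> doubly_stochastic V (A r)"
    and conn: "\<And>i j. i \<in> V \<Longrightarrow> j \<in> V \<Longrightarrow>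
        (i, j) \<in> {(j, i). i \<in> V \<and> j \<in> V \<and> 0 < (\<Sum>r\<in>S. A r i j)}\<^sup>*"
    and \<alpha>: "\<And>k. 0 < \<alpha> k" "decseq \<alpha>" "\<alpha> \<longlonglongrightarrow> 0" "\<And>k s. \<alpha> k \<le> real (Suc s) * \<alpha> (k + s)"
    and \<beta>: "\<And>k. 0 < \<beta> k" "decseq \<beta>" "\<not> summable \<beta>" "summable (\<lambda>k. (\<beta> k)\<^sup>2)"
    and \<beta>\<alpha>: "decseq (\<lambda>k. \<beta> k / \<alpha> k)" "summable (\<lambda>k. \<beta> k / \<alpha> k * \<beta> k)"
    and centred: "\<And>k \<omega>. \<omega> \<in> space M \<Longrightarrow> (\<Sum>i\<in>V. \<eta> k \<omega> i) = 0"
    and step: "\<And>k \<omega> i. \<omega> \<in> space M \<Longrightarrow> i \<in> V \<Longrightarrow>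
        \<eta> (Suc k) \<omega> i = \<eta> k \<omega> i + \<alpha> k *\<^sub>R laplacian V (A (\<theta> k \<omega>)) (\<eta> k \<omega>) i + \<xi> k \<omega> i"
    and noise: "\<And>k \<omega>. \<omega> \<in> space M \<Longrightarrow> L2_vec V (\<xi> k \<omega>) \<le> C * \<beta> k" and C: "0 \<le> C"
    and init: "\<And>\<omega>. \<omega> \<in> space M \<Longrightarrow> L2_vec V (\<eta> 0 \<omega>) \<le> B0"
  shows "AE \<omega> in M. summable (\<lambda>k. \<beta> k * L2_vec V (\<eta> k \<omega>)) \<and> (\<lambda>k. L2_vec V (\<eta> k \<omega>)) \<longlonglongrightarrow> 0"
proof -
  have \<theta>S: "\<theta> k \<omega> \<in> S" if "\<omega> \<in> space M" for k \<omega> using markov_chain_space[OF chain S that] .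
  have "S \<noteq> {}" using \<theta>S not_empty by auto

  \<comment> \<open>Constants: connectivity, covering, block length and gain threshold\<close>
  have A_nonneg: "0 \<le> (\<Sum>r\<in>S. A r i j)" if "i \<in> V" "j \<in> V" for i j
    by (intro sum_nonneg doubly_nonneg[OF doubly] that)
  have dis: "disagreement V (\<lambda>i j. \<Sum>r\<in>S. A r i j) z = (\<Sum>r\<in>S. disagreement V (A r) z)" for z :: "'v \<Rightarrow> 'b"
    unfolding disagreement_def sum_distrib_right
    by (subst (2) sum.swap) (intro sum.cong refl sum.swap)
  obtain c where c: "c > 0"
    "\<And>z :: 'v \<Rightarrow> 'b. (\<Sum>i\<in>V. z i) = 0 \<Longrightarrow> c * (L2_vec V z)\<^sup>2 \<le> (\<Sum>r\<in>S. disagreement V (A r) z)"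
    using disagreement_ge[OF V A_nonneg conn, where 'a='b, unfolded dis] by blast
  obtain n p where p: "0 < p" "\<And>i. i \<in> S \<Longrightarrow> p \<le> cover_prob S P n S i"
    by (rule cover_prob_uniform[OF markov_chain_row[OF chain S] S irred], rule that)
  \<comment> \<open>A block with \<open>n\<close> transitions sees \<open>n + 1\<close> states, and
    each of them drives one averaging step.\<close>
  define h where "h = Suc n"
  \<comment> \<open>By the slow decay of \<open>\<alpha>\<close>, gains within a block are at least
    \<open>1 / h\<close> times the first one.\<close>
  define \<kappa> where "\<kappa> = 1 / real h"
  define c1 where "c1 = c * \<kappa> / real (card S)"
  have \<kappa>: "0 < \<kappa>" by (simp add: \<kappa>_def h_def)
  have c1: "0 < c1" using c \<kappa> S \<open>S \<noteq> {}\<close> by (simp add: c1_def card_gt_0_iff)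
  \<comment> \<open>The three thresholds keep averaging nonexpansive, keep the contraction factor
    nonnegative, and let the second-order term consume at most half of the first-order decrease
    \<open>c1 / 2\<close>.\<close>
  define a0 where "a0 = min 1 (min (1 / c1) (c1 / (24 * (real h)\<^sup>2)))"
  have "0 < a0" using c1 by (simp add: a0_def h_def)
  then have "\<forall>\<^sub>F k in sequentially. \<alpha> k < a0" using order_tendstoD(2)[OF \<alpha>(3)] by blast
  then obtain k0 where "\<And>k. k \<ge> k0 \<Longrightarrow> \<alpha> k < a0" by (auto simp: eventually_sequentially)
  then have small: "\<alpha> k \<le> 1" "c1 * \<alpha> k \<le> 1" "24 * (real h)\<^sup>2 * \<alpha> k \<le> c1" if "k \<ge> k0" for k
    using that c1 by (auto simp: a0_def h_def field_simps dest!: meta_spec[of _ k])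
  define K where "K b = k0 + b * h" for b
  define y where "y k \<omega> = L2_vec V (\<eta> k \<omega>)" for k \<omega>
  \<comment> \<open>The noise constant of a contracting block. It also dominates
    \<open>h * C\<close>, the growth constant of any block, so that one recursion covers both
    cases.\<close>
  define C1 where "C1 = (2 * (real h)\<^sup>2 * (2 * real h + 1) + real h) * C"
  have C1: "real h * C \<le> C1" "0 \<le> C1" using C by (auto simp: C1_def algebra_simps)

  \<comment> \<open>Growth and contraction along a single path\<close>
  have one: "y (Suc k) \<omega> \<le> y k \<omega> + C * \<beta> k" if "\<omega> \<in> space M" "k0 \<le> k" for k \<omega>
  proof -
    let ?z = "\<lambda>i. \<eta> k \<omega> i + \<alpha> k *\<^sub>R laplacian V (A (\<theta> k \<omega>)) (\<eta> k \<omega>) i"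
    have "y (Suc k) \<omega> = L2_vec V (\<lambda>i. ?z i + \<xi> k \<omega> i)"
      unfolding y_def by (rule L2_vec_cong) (rule step[OF that(1)])
    also have "\<dots> \<le> L2_vec V ?z + L2_vec V (\<xi> k \<omega>)"
      by (rule L2_vec_add)
    also have "\<dots> \<le> y k \<omega> + C * \<beta> k"
      unfolding y_def using \<alpha>(1)[of k] small(1)[OF that(2)]
      by (intro add_mono noise L2_vec_lazy_averaging doubly \<theta>S V that) auto
    finally show ?thesis .
  qed
  have within: "y (K b + s) \<omega> \<le> y (K b) \<omega> + real s * (C * \<beta> (K b))" if "\<omega> \<in> space M" for b s \<omega>
  proof (induction s)
    case (Suc s)
    have "y (K b + Suc s) \<omega> \<le> y (K b + s) \<omega> + C * \<beta> (K b + s)"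
      using one[OF that, of "K b + s"] by (simp add: K_def)
    also have "\<dots> \<le> y (K b + s) \<omega> + C * \<beta> (K b)"
      using decseqD[OF \<beta>(2)] C by (intro add_left_mono mult_left_mono) auto
    finally show ?case using Suc by (simp add: algebra_simps)
  qed simp
  have contract: "y (K (Suc b)) \<omega> \<le> (1 - c1 / 4 * \<alpha> (K b)) * y (K b) \<omega> + C1 * \<beta> (K b)"
    if w: "\<omega> \<in> space M" "\<omega> \<in> cover_event \<theta> (K b) n S" for b \<omega>
  proof -
    let ?a = "\<alpha> (K b)"
    have sm: "?a \<le> 1" "c1 * ?a \<le> 1" "24 * (real h)\<^sup>2 * ?a \<le> c1" using small[of "K b"] by (auto simp: K_def)
    have visit: "\<exists>s<h. A (\<theta> (K b + s) \<omega>) = A r" if "r \<in> S" for r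
    proof -
      obtain t where "t \<in> {K b..K b + n}" "r = \<theta> t \<omega>"
        using w(2) \<open>r \<in> S\<close> by (auto simp: cover_event_def)
      then show ?thesis by (intro exI[of _ "t - K b"]) (auto simp: h_def)
    qed
    have "L2_vec V (\<eta> (K b + h) \<omega>) \<le> (1 - c * \<kappa> / (2 * real (card S)) * ?a + 6 * (real h)\<^sup>2 * ?a\<^sup>2) * L2_vec V (\<eta> (K b + 0) \<omega>)
        + (2 * (real h)\<^sup>2 * (2 * real h + 1) + real h) * (C * \<beta> (K b))"
    proof (rule perturbed_averaging_contraction[where z="\<lambda>s. \<eta> (K b + s) \<omega>" and p="\<lambda>s. \<xi> (K b + s) \<omega>"
          and B="\<lambda>s. A (\<theta> (K b + s) \<omega>)" and \<alpha>="\<lambda>s. \<alpha> (K b + s)" and A=A and a="?a" and h=h, OF V(1)])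
      show "L2_vec V (\<xi> (K b + s) \<omega>) \<le> C * \<beta> (K b)" for s
        by (rule order_trans[OF noise[OF w(1)]]) (use decseqD[OF \<beta>(2)] C in \<open>auto intro: mult_left_mono\<close>)
      show "\<kappa> * ?a \<le> \<alpha> (K b + s)" if "s < h" for s
      proof -
        have "?a \<le> real h * \<alpha> (K b + s)"
          by (rule order_trans[OF \<alpha>(4)[of _ s]]) (use that \<alpha>(1)[of "K b + s"] in \<open>auto intro!: mult_right_mono\<close>)
        then show ?thesis by (simp add: \<kappa>_def h_def field_simps)
      qed
      show "c * \<kappa> / real (card S) * ?a \<le> 1" using sm by (simp add: c1_def)
      show "c * (L2_vec V (\<eta> (K b + 0) \<omega>))\<^sup>2 \<le> (\<Sum>r\<in>S. disagreement V (A r) (\<eta> (K b + 0) \<omega>))"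
        by (rule c(2)) (use centred w in auto)
    qed (use w(1) doubly \<theta>S \<alpha>(1,2) \<beta>(1) C sm(1) step visit \<kappa> c(1) S \<open>S \<noteq> {}\<close> in
        \<open>auto simp: decseq_def less_imp_le intro!: mult_nonneg_nonneg\<close>)
    also have "(2 * (real h)\<^sup>2 * (2 * real h + 1) + real h) * (C * \<beta> (K b)) = C1 * \<beta> (K b)"
      by (simp add: C1_def)
    also have "(1 - c * \<kappa> / (2 * real (card S)) * ?a + 6 * (real h)\<^sup>2 * ?a\<^sup>2) * L2_vec V (\<eta> (K b + 0) \<omega>)
        \<le> (1 - c1 / 4 * ?a) * L2_vec V (\<eta> (K b + 0) \<omega>)"
    proof (rule mult_right_mono)
      have "24 * (real h)\<^sup>2 * ?a * ?a \<le> c1 * ?a" using sm(3) \<alpha>(1)[of "K b"] by (intro mult_right_mono) auto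
      then have "6 * (real h)\<^sup>2 * ?a\<^sup>2 \<le> c1 / 4 * ?a" by (simp add: power2_eq_square mult.assoc)
      moreover have "c * \<kappa> / (2 * real (card S)) * ?a = c1 / 2 * ?a" by (simp add: c1_def)
      ultimately show "1 - c * \<kappa> / (2 * real (card S)) * ?a + 6 * (real h)\<^sup>2 * ?a\<^sup>2 \<le> 1 - c1 / 4 * ?a"
        by simp
    qed simp
    finally show ?thesis by (simp add: y_def K_def add_ac)
  qed
  \<comment> \<open>Before \<open>k0\<close> the gain may exceed 1, so a crude growth estimate is
    used. Its uniformity in \<open>\<omega>\<close> allows the majorant to start from a
    constant.\<close>
  have bdd: "\<exists>B. \<forall>\<omega>\<in>space M. L2_vec V (\<eta> k \<omega>) \<le> B" for k
  proof (induction k)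
    case (Suc k)
    then obtain B where B: "\<And>\<omega>. \<omega> \<in> space M \<Longrightarrow> L2_vec V (\<eta> k \<omega>) \<le> B" by blast
    have "L2_vec V (\<eta> (Suc k) \<omega>) \<le> B + \<alpha> k * (2 * B) + C * \<beta> k" if w: "\<omega> \<in> space M" for \<omega>
    proof -
      let ?L = "laplacian V (A (\<theta> k \<omega>)) (\<eta> k \<omega>)"
      have "L2_vec V (\<eta> (Suc k) \<omega>) = L2_vec V (\<lambda>i. (\<eta> k \<omega> i + \<alpha> k *\<^sub>R ?L i) + \<xi> k \<omega> i)"
        by (rule L2_vec_cong) (rule step[OF w])
      also have "\<dots> \<le> L2_vec V (\<eta> k \<omega>) + \<alpha> k * L2_vec V ?L + L2_vec V (\<xi> k \<omega>)"
        using L2_vec_add[of V "\<lambda>i. \<eta> k \<omega> i + \<alpha> k *\<^sub>R ?L i" "\<xi> k \<omega>"]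
          L2_vec_add[of V "\<eta> k \<omega>" "\<lambda>i. \<alpha> k *\<^sub>R ?L i"] \<alpha>(1)[of k] by (simp add: L2_vec_scaleR)
      also have "L2_vec V ?L \<le> 2 * B"
        using L2_vec_laplacian[OF doubly[OF \<theta>S[OF w]] V(1), of k "\<eta> k \<omega>"] B[OF w] by simp
      finally show ?thesis using B[OF w] noise[OF w, of k] \<alpha>(1)[of k] by simp
    qed
    then show ?case by blast
  qed (use init in blast)
  obtain B where B: "\<And>\<omega>. \<omega> \<in> space M \<Longrightarrow> y k0 \<omega> \<le> B" using bdd[of k0] by (auto simp: y_def)

  \<comment> \<open>The scalar majorant and its almost sure summability\<close>
  define Y where "Y = rec_nat (\<lambda>\<omega>. max 0 B)
    (\<lambda>b Yb \<omega>. (1 - c1 / 4 * \<alpha> (K b) * indicator (cover_event \<theta> (K b) n S) \<omega>) * Yb \<omega> + C1 * \<beta> (K b))"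
  have Y0: "Y 0 \<omega> = max 0 B" and Y_Suc: "Y (Suc b) \<omega>
      = (1 - c1 / 4 * \<alpha> (K b) * indicator (cover_event \<theta> (K b) n S) \<omega>) * Y b \<omega> + C1 * \<beta> (K b)" for b \<omega>
    by (simp_all add: Y_def)
  have u: "0 \<le> c1 / 4 * \<alpha> (K b)" "c1 / 4 * \<alpha> (K b) \<le> 1" for b
    using c1 \<alpha>(1)[of "K b"] small(2)[of "K b"] by (auto simp: K_def)
  have yY: "y (K b) \<omega> \<le> Y b \<omega>" if "\<omega> \<in> space M" for b \<omega>
  proof (induction b)
    case 0
    then show ?case using B[OF that] by (simp add: Y0 K_def)
  next
    case (Suc b)
    show ?case
    proof (cases "\<omega> \<in> cover_event \<theta> (K b) n S")
      case True
      have "(1 - c1 / 4 * \<alpha> (K b)) * y (K b) \<omega> \<le> (1 - c1 / 4 * \<alpha> (K b)) * Y b \<omega>"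
        using Suc u(2)[of b] by (intro mult_left_mono) auto
      then show ?thesis using contract[OF that True] True by (simp add: Y_Suc)
    next
      case False
      have "real h * C * \<beta> (K b) \<le> C1 * \<beta> (K b)" using C1(1) \<beta>(1)[of "K b"] by (intro mult_right_mono) auto
      then show ?thesis using within[OF that, of b h] Suc False
        by (simp add: Y_Suc K_def add_ac mult.assoc)
    qed
  qed
  have K_ge: "b \<le> K b" for b by (simp add: K_def h_def)
  have K_mono: "K b \<le> K (Suc b)" for b by (simp add: K_def)
  \<comment> \<open>For a decreasing sequence, \<open>b \<le> K b\<close> gives the comparison of
    \<open>g (K b)\<close> with \<open>g b\<close>.\<close>
  have sum_K: "summable (\<lambda>b. g (K b))" if "summable g" "decseq g" "\<And>k. 0 \<le> g k" for g :: "nat \<Rightarrow> real"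
    by (rule summable_comparison_test'[OF that(1)]) (use that(3) decseqD[OF that(2) K_ge] in auto)
  have "decseq (\<lambda>k. \<beta> k / \<alpha> k * \<beta> k)"
    by (intro decseq_SucI mult_mono decseqD[OF \<beta>\<alpha>(1)] decseqD[OF \<beta>(2)])
       (use \<beta>(1) \<alpha>(1) in \<open>auto simp: less_imp_le\<close>)
  then have "summable (\<lambda>b. \<beta> (K b) / \<alpha> (K b) * \<beta> (K b))"
    by (intro sum_K \<beta>\<alpha>) (use \<beta>(1) \<alpha>(1) in \<open>auto simp: less_imp_le\<close>)
  from summable_mult[OF this, of C1] have we: "summable (\<lambda>b. \<beta> (K b) / \<alpha> (K b) * (C1 * \<beta> (K b)))"
    by (simp add: mult_ac)
  have sum_\<beta>2: "summable (\<lambda>b. (\<beta> (K b))\<^sup>2)"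
    using sum_K[OF \<beta>(4)] \<beta>(1,2) by (simp add: decseq_Suc_iff less_imp_le power_mono)
  \<comment> \<open>The weight \<open>\<beta> / \<alpha>\<close> cancels the gain in the contraction
    rate, so only \<open>\<beta>\<close> times the majorant remains up to a constant.\<close>
  have "AE \<omega> in M. summable (\<lambda>b. \<beta> (K b) / \<alpha> (K b) * (c1 / 4 * \<alpha> (K b)) * Y b \<omega>)"
  proof (rule AE_summable_contractions[OF chain S p _ Y0 _ Y_Suc u _ _ _ we])
    show "decseq (\<lambda>b. \<beta> (K b) / \<alpha> (K b))"
      unfolding decseq_Suc_iff using decseqD[OF \<beta>\<alpha>(1)] K_mono by blast
  qed (use C1 \<beta>(1) \<alpha>(1) in \<open>auto simp: K_def h_def less_imp_le\<close>)

  \<comment> \<open>From block starts to all times\<close>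
  with AE_space show ?thesis
  proof (eventually_elim, goal_cases)
    case (1 \<omega>)
    have eq: "(\<lambda>b. \<beta> (K b) / \<alpha> (K b) * (c1 / 4 * \<alpha> (K b)) * Y b \<omega>) = (\<lambda>b. c1 / 4 * (\<beta> (K b) * Y b \<omega>))"
      using \<alpha>(1) by (auto simp: less_imp_neq[symmetric])
    from summable_mult[OF 1(2)[unfolded eq], of "4 / c1"]
    have sumY: "summable (\<lambda>b. \<beta> (K b) * Y b \<omega>)" using c1 by simp
    have "summable (\<lambda>k. \<beta> (k + k0) * y (k + k0) \<omega>)"
    proof (rule summable_of_blocks)
      show "summable (\<lambda>b. real h * (\<beta> (K b) * Y b \<omega> + real h * C * (\<beta> (K b))\<^sup>2))"
        by (intro summable_mult summable_add sumY sum_\<beta>2)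
      fix b
      have "\<beta> (b * h + s + k0) * y (b * h + s + k0) \<omega> \<le> \<beta> (K b) * Y b \<omega> + real h * C * (\<beta> (K b))\<^sup>2"
        if s: "s < h" for s
      proof -
        have "y (K b + s) \<omega> \<le> y (K b) \<omega> + real s * (C * \<beta> (K b))" by (rule within[OF 1(1)])
        also have "\<dots> \<le> Y b \<omega> + real h * (C * \<beta> (K b))"
          using yY[OF 1(1)] s C \<beta>(1)[of "K b"] by (intro add_mono mult_right_mono) auto
        finally have "\<beta> (K b + s) * y (K b + s) \<omega> \<le> \<beta> (K b) * (Y b \<omega> + real h * (C * \<beta> (K b)))"
          using decseqD[OF \<beta>(2), of "K b" "K b + s"] \<beta>(1)[of "K b"] by (intro mult_mono) (auto simp: y_def)
        then show ?thesis by (simp add: K_def algebra_simps power2_eq_square)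
      qed
      then have "(\<Sum>s<h. \<beta> (b * h + s + k0) * y (b * h + s + k0) \<omega>)
          \<le> (\<Sum>s<h. \<beta> (K b) * Y b \<omega> + real h * C * (\<beta> (K b))\<^sup>2)"
        by (intro sum_mono) auto
      then show "(\<Sum>s<h. \<beta> (b * h + s + k0) * y (b * h + s + k0) \<omega>)
          \<le> real h * (\<beta> (K b) * Y b \<omega> + real h * C * (\<beta> (K b))\<^sup>2)" by simp
    qed (use \<beta>(1) in \<open>auto simp: h_def y_def less_imp_le intro!: mult_nonneg_nonneg\<close>)
    moreover from this have "(\<lambda>k. y (k + k0) \<omega>) \<longlonglongrightarrow> 0"
    proof (rule weighted_summable_tendsto_zero[rotated 5])
      show "y (Suc k + k0) \<omega> \<le> y (k + k0) \<omega> + C * \<beta> (k + k0)" for k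
        using one[OF 1(1), of "k + k0"] by simp
      show "\<not> summable (\<lambda>k. \<beta> (k + k0))" "summable (\<lambda>k. (\<beta> (k + k0))\<^sup>2)"
        using \<beta>(3,4) summable_iff_shift[of \<beta> k0] summable_iff_shift[of "\<lambda>k. (\<beta> k)\<^sup>2" k0] by auto
    qed (use \<beta>(1) C in \<open>auto simp: y_def less_imp_le\<close>)
    ultimately show ?case
      using summable_iff_shift[of "\<lambda>k. \<beta> k * y k \<omega>" k0] LIMSEQ_offset[of "\<lambda>k. y k \<omega>" k0]
      by (simp add: y_def)
  qed
qed

theorem theorem2:
  fixes N m :: nat
    and f :: "nat \<Rightarrow> real ^ 'n \<Rightarrow> real"
    and Xopt :: "(real ^ 'n) set"
    and l :: real
    and G :: "nat \<Rightarrow> nat weighted_digraph"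
    and M :: "'w measure"
    and P :: "nat \<Rightarrow> nat \<Rightarrow> real"
    and \<theta> :: "nat \<Rightarrow> 'w \<Rightarrow> nat"
    and a\<^sub>1 a\<^sub>2 \<delta>\<^sub>1 \<delta>\<^sub>2 :: real
    and \<alpha> \<beta> :: "nat \<Rightarrow> real"
    and x d :: "nat \<Rightarrow> nat \<Rightarrow> 'w \<Rightarrow> real ^ 'n"
    and x0 :: "nat \<Rightarrow> real ^ 'n"
  assumes lsc: "\<And>i. i \<in> {1..N} \<Longrightarrow> lower_semicontinuous (f i)"
    and convex: "\<And>i. i \<in> {1..N} \<Longrightarrow> convex_on UNIV (f i)"
    and Xopt: "Xopt = {y. is_arg_min (\<lambda>z. \<Sum>i\<in>{1..N}. f i z) (\<lambda>_. True) y}"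
    and nonempty: "Xopt \<noteq> {}"
    and bounded: "\<And>i y g. i \<in> {1..N} \<Longrightarrow> g \<in> subdifferential (f i) y \<Longrightarrow> norm g \<le> l"
    and graphs: "\<And>r. r \<in> {1..m} \<Longrightarrow> weighted_digraph {1..N} (G r)"
    and balanced: "\<And>r. r \<in> {1..m} \<Longrightarrow> doubly_stochastic {1..N} (adj (G r))"
    and connected: "strongly_connected
          (with_proj \<lparr>pverts = {1..N}, parcs = (\<Union>r\<in>{1..m}. edges (G r))\<rparr>)"
    and prob: "prob_space M"
    and chain: "markov_chain M {1..m} P \<theta>"
    and irreducible: "irreducible_transitions {1..m} P"
    and \<alpha>: "\<And>k. \<alpha> k = a\<^sub>1 / (real k + 1) powr \<delta>\<^sub>1"
    and \<beta>: "\<And>k. \<beta> k = a\<^sub>2 / (real k + 1) powr \<delta>\<^sub>2"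
    and gains: "a\<^sub>1 > 0" "a\<^sub>2 > 0"
    and exponents: "0 < \<delta>\<^sub>1" "\<delta>\<^sub>1 < \<delta>\<^sub>2" "\<delta>\<^sub>2 \<le> 1" "\<delta>\<^sub>2 - \<delta>\<^sub>1 \<ge> 1 / 2"
    and measurable_x: "\<And>i k. i \<in> {1..N} \<Longrightarrow> x i k \<in> borel_measurable M"
    and measurable_d: "\<And>i k. i \<in> {1..N} \<Longrightarrow> d i k \<in> borel_measurable M"
    and init: "\<And>i \<omega>. i \<in> {1..N} \<Longrightarrow> \<omega> \<in> space M \<Longrightarrow> x i 0 \<omega> = x0 i"
    and subgradient: "\<And>i k \<omega>. i \<in> {1..N} \<Longrightarrow> \<omega> \<in> space M \<Longrightarrow>
          d i k \<omega> \<in> subdifferential (f i) (x i k \<omega>)"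
    and update: "\<And>i k \<omega>. i \<in> {1..N} \<Longrightarrow> \<omega> \<in> space M \<Longrightarrow>
          x i (Suc k) \<omega> = x i k \<omega>
            + \<alpha> k *\<^sub>R (\<Sum>j\<in>{1..N}. adj (G (\<theta> k \<omega>)) i j *\<^sub>R (x j k \<omega> - x i k \<omega>))
            - \<beta> k *\<^sub>R d i k \<omega>"
  shows "AE \<omega> in M. \<exists>xstar\<in>Xopt. \<forall>i\<in>{1..N}. (\<lambda>k. x i k \<omega>) \<longlonglongrightarrow> xstar"
proof -
  interpret prob_space M by (rule prob)
  let ?V = "{1..N}" and ?S = "{1..m}"
  define A where "A r = adj (G r)" for r
  have doubly: "doubly_stochastic ?V (A r)" if "r \<in> ?S" for r using balanced[OF that] by (simp add: A_def)
  \<comment> \<open>Strong connectivity includes that the vertex set is nonempty, so there is at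
    least one agent.\<close>
  have V: "finite ?V" "?V \<noteq> {}" using connected by (auto simp: strongly_connected_def)
  have N: "0 < real N" using V by auto
  have \<theta>S: "\<theta> k \<omega> \<in> ?S" if "\<omega> \<in> space M" for k \<omega> by (rule markov_chain_space[OF chain _ that]) simp
  obtain i0 where i0: "i0 \<in> ?V" using V by blast
  \<comment> \<open>The existence of a subgradient forces its norm bound \<open>l\<close> to be
    nonnegative.\<close>
  obtain g0 where "g0 \<in> subdifferential (f i0) 0" using subdifferential_nonempty[OF convex[OF i0]] by blast
  then have l: "0 \<le> l" using bounded[OF i0] norm_ge_zero order_trans by blast
  have lip: "f i y - f i z \<le> l * norm (y - z)" if "i \<in> ?V" for i y z
    by (rule bounded_subdifferential_lipschitz[OF convex[OF that] bounded[OF that]])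
  have d_le: "norm (d i k \<omega>) \<le> l" if "i \<in> ?V" "\<omega> \<in> space M" for i k \<omega>
    by (rule bounded[OF that(1) subgradient[OF that]])

  \<comment> \<open>Connectivity of the summed weights\<close>
  have conn: "(u, v) \<in> {(j, i). i \<in> ?V \<and> j \<in> ?V \<and> 0 < (\<Sum>r\<in>?S. A r i j)}\<^sup>*" if "u \<in> ?V" "v \<in> ?V" for u v
  proof -
    let ?U = "with_proj \<lparr>pverts = ?V, parcs = (\<Union>r\<in>?S. edges (G r))\<rparr>"
    have "u \<rightarrow>\<^sup>*\<^bsub>?U\<^esub> v" using connected that by (auto simp: strongly_connected_def)
    then have "(u, v) \<in> (arcs_ends ?U)\<^sup>*" by (rule reachable_rtranclI)
    moreover have "arcs_ends ?U \<subseteq> {(j, i). i \<in> ?V \<and> j \<in> ?V \<and> 0 < (\<Sum>r\<in>?S. A r i j)}"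
    proof clarify
      fix j i assume "(j, i) \<in> arcs_ends ?U"
      then obtain r where r: "r \<in> ?S" "(j, i) \<in> edges (G r)" by (auto simp: arcs_ends_def arc_to_ends_def)
      then have ij: "i \<in> ?V" "j \<in> ?V" using graphs[OF r(1)] by (auto simp: weighted_digraph_def)
      have "0 < A r i j" using graphs[OF r(1)] r(2) ij unfolding weighted_digraph_def A_def by metis
      also have "\<dots> \<le> (\<Sum>r\<in>?S. A r i j)"
        using r(1) doubly_nonneg[OF doubly ij] by (intro member_le_sum) auto
      finally show "i \<in> ?V \<and> j \<in> ?V \<and> 0 < (\<Sum>r\<in>?S. A r i j)" using ij by simp
    qed
    ultimately show ?thesis using rtrancl_mono by blast
  qed

  \<comment> \<open>Properties of the step sizes\<close>
  have \<alpha>': "\<alpha> k = a\<^sub>1 * (real k + 1) powr - \<delta>\<^sub>1" and \<beta>': "\<beta> k = a\<^sub>2 * (real k + 1) powr - \<delta>\<^sub>2" for k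
    by (simp_all add: \<alpha> \<beta> powr_minus_divide)
  have \<beta>\<alpha>': "\<beta> k / \<alpha> k = a\<^sub>2 / a\<^sub>1 * (real k + 1) powr - (\<delta>\<^sub>2 - \<delta>\<^sub>1)" for k
    by (simp add: \<alpha> \<beta> powr_diff powr_minus_divide)
  have \<alpha>_pos: "0 < \<alpha> k" and \<beta>_pos: "0 < \<beta> k" for k using gains by (simp_all add: \<alpha> \<beta>)
  have decseq_powr: "decseq (\<lambda>k. c * (real k + 1) powr - s)" if "0 \<le> c" "0 \<le> s" for c s :: real
    using that by (auto simp: decseq_def intro!: mult_left_mono powr_mono2')
  have \<alpha>_lim: "\<alpha> \<longlonglongrightarrow> 0"
  proof -
    have "filterlim (\<lambda>k. real k + 1) at_top sequentially"
      by (rule filterlim_at_top_mono[OF filterlim_real_sequentially]) auto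
    then have "(\<lambda>k. a\<^sub>1 * (real k + 1) powr - \<delta>\<^sub>1) \<longlonglongrightarrow> a\<^sub>1 * 0"
      using exponents by (intro tendsto_mult tendsto_const tendsto_neg_powr) auto
    then show ?thesis by (simp add: \<alpha>'[abs_def])
  qed
  \<comment> \<open>This combines \<open>k + s + 1 \<le> (s + 1) * (k + 1)\<close> with
    \<open>\<delta>\<^sub>1 \<le> 1\<close>.\<close>
  have \<alpha>_slow: "\<alpha> k \<le> real (Suc s) * \<alpha> (k + s)" for k s
  proof -
    have "(real (k + s) + 1) powr \<delta>\<^sub>1 \<le> (real (Suc s) * (real k + 1)) powr \<delta>\<^sub>1"
      using exponents by (intro powr_mono2) (auto simp: algebra_simps)
    also have "\<dots> = real (Suc s) powr \<delta>\<^sub>1 * (real k + 1) powr \<delta>\<^sub>1"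
      by (simp add: powr_mult)
    also have "\<dots> \<le> real (Suc s) powr 1 * (real k + 1) powr \<delta>\<^sub>1"
      using exponents by (intro mult_right_mono powr_mono) auto
    finally have "(real (k + s) + 1) powr \<delta>\<^sub>1 \<le> real (Suc s) * (real k + 1) powr \<delta>\<^sub>1" by simp
    then have "a\<^sub>1 * (real (k + s) + 1) powr \<delta>\<^sub>1 \<le> a\<^sub>1 * (real (Suc s) * (real k + 1) powr \<delta>\<^sub>1)"
      using gains by (intro mult_left_mono) auto
    then show ?thesis unfolding \<alpha> by (simp add: divide_le_eq pos_le_divide_eq mult_ac)
  qed
  have \<beta>_div: "\<not> summable \<beta>"
    using summable_shifted_powr_iff[of "- \<delta>\<^sub>2"] exponents gains by (simp add: \<beta>'[abs_def] summable_cmult_iff)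
  have sq: "(\<beta> k)\<^sup>2 = a\<^sub>2\<^sup>2 * (real k + 1) powr - (2 * \<delta>\<^sub>2)" for k
    by (simp add: \<beta>' power_mult_distrib powr_power)
  \<comment> \<open>The exponent satisfies
    \<open>2 * \<delta>\<^sub>2 \<ge> 1 + 2 * \<delta>\<^sub>1 > 1\<close>.\<close>
  have \<beta>_sq: "summable (\<lambda>k. (\<beta> k)\<^sup>2)"
    unfolding sq using exponents by (intro summable_mult) (simp add: summable_shifted_powr_iff)
  have ratio: "\<beta> k / \<alpha> k * \<beta> k = a\<^sub>2 / a\<^sub>1 * a\<^sub>2 * (real k + 1) powr - (2 * \<delta>\<^sub>2 - \<delta>\<^sub>1)" for k
  proof -
    have "(real k + 1) powr - (2 * \<delta>\<^sub>2 - \<delta>\<^sub>1) = (real k + 1) powr - (\<delta>\<^sub>2 - \<delta>\<^sub>1) * (real k + 1) powr - \<delta>\<^sub>2"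
      by (simp add: powr_add[symmetric])
    then show ?thesis unfolding \<beta>\<alpha>' unfolding \<beta>' by simp
  qed
  \<comment> \<open>Here \<open>2 * \<delta>\<^sub>2 - \<delta>\<^sub>1 = 2 * (\<delta>\<^sub>2 -
    \<delta>\<^sub>1) + \<delta>\<^sub>1 \<ge> 1 + \<delta>\<^sub>1 > 1\<close>.\<close>
  have ratio_sum: "summable (\<lambda>k. \<beta> k / \<alpha> k * \<beta> k)"
    unfolding ratio using exponents by (intro summable_mult) (simp add: summable_shifted_powr_iff)

  \<comment> \<open>Dynamics of the average and of the deviations\<close>
  define q where "q k \<omega> = (1 / real N) *\<^sub>R (\<Sum>i\<in>?V. x i k \<omega>)" for k \<omega>
  define D where "D k \<omega> = (1 / real N) *\<^sub>R (\<Sum>i\<in>?V. d i k \<omega>)" for k \<omega>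
  define \<eta> where "\<eta> k \<omega> i = x i k \<omega> - q k \<omega>" for k \<omega> i
  define \<xi> where "\<xi> k \<omega> i = - \<beta> k *\<^sub>R (d i k \<omega> - D k \<omega>)" for k \<omega> i
  have x_Suc: "x i (Suc k) \<omega> = x i k \<omega> + \<alpha> k *\<^sub>R laplacian ?V (A (\<theta> k \<omega>)) (\<lambda>i. x i k \<omega>) i - \<beta> k *\<^sub>R d i k \<omega>"
    if "i \<in> ?V" "\<omega> \<in> space M" for i k \<omega>
    using update[OF that] by (simp add: laplacian_def A_def)
  have q_Suc: "q (Suc k) \<omega> = q k \<omega> - \<beta> k *\<^sub>R D k \<omega>" if w: "\<omega> \<in> space M" for k \<omega>
  proof -
    have "(\<Sum>i\<in>?V. x i (Suc k) \<omega>) = (\<Sum>i\<in>?V. x i k \<omega>)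
        + \<alpha> k *\<^sub>R (\<Sum>i\<in>?V. laplacian ?V (A (\<theta> k \<omega>)) (\<lambda>i. x i k \<omega>) i) - \<beta> k *\<^sub>R (\<Sum>i\<in>?V. d i k \<omega>)"
      by (simp add: x_Suc w sum.distrib sum_subtractf scaleR_sum_right)
    also have "(\<Sum>i\<in>?V. laplacian ?V (A (\<theta> k \<omega>)) (\<lambda>i. x i k \<omega>) i) = 0"
      by (rule sum_laplacian[OF doubly[OF \<theta>S[OF w]]])
    finally show ?thesis by (simp add: q_def D_def scaleR_diff_right mult.commute)
  qed
  have "AE \<omega> in M. summable (\<lambda>k. \<beta> k * L2_vec ?V (\<eta> k \<omega>)) \<and> (\<lambda>k. L2_vec ?V (\<eta> k \<omega>)) \<longlonglongrightarrow> 0"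
  proof (rule AE_consensus[OF V _ chain irreducible doubly conn \<alpha>_pos _ \<alpha>_lim \<alpha>_slow \<beta>_pos _ \<beta>_div \<beta>_sq _ ratio_sum])
    show "decseq \<alpha>" unfolding \<alpha>'[abs_def] by (rule decseq_powr) (use gains exponents in auto)
    show "decseq \<beta>" unfolding \<beta>'[abs_def] by (rule decseq_powr) (use gains exponents in auto)
    show "decseq (\<lambda>k. \<beta> k / \<alpha> k)" unfolding \<beta>\<alpha>' by (rule decseq_powr) (use gains exponents in auto)
    show "(\<Sum>i\<in>?V. \<eta> k \<omega> i) = 0" for k \<omega>
      using N by (simp add: \<eta>_def q_def sum_subtractf sum_constant_scaleR del: sum_constant)
    show "\<eta> (Suc k) \<omega> i = \<eta> k \<omega> i + \<alpha> k *\<^sub>R laplacian ?V (A (\<theta> k \<omega>)) (\<eta> k \<omega>) i + \<xi> k \<omega> i"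
      if "\<omega> \<in> space M" "i \<in> ?V" for k \<omega> i
      unfolding \<eta>_def \<xi>_def x_Suc[OF that(2,1)] q_Suc[OF that(1)] laplacian_translate
      by (simp add: algebra_simps)
    \<comment> \<open>Each agent's noise is at most \<open>2 * l * \<beta> k\<close>, and the
      stacked norm is at most the sum of the \<open>N\<close> individual norms.\<close>
    show "L2_vec ?V (\<xi> k \<omega>) \<le> (real N * (2 * l)) * \<beta> k" if w: "\<omega> \<in> space M" for k \<omega>
    proof -
      have "norm (\<Sum>i\<in>?V. d i k \<omega>) \<le> (\<Sum>i\<in>?V. l)"
        by (rule order_trans[OF norm_sum]) (intro sum_mono d_le w)
      then have "norm (D k \<omega>) \<le> l" using N by (simp add: D_def field_simps)
      then have "norm (\<xi> k \<omega> i) \<le> \<beta> k * (2 * l)" if "i \<in> ?V" for i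
        using norm_triangle_ineq4[of "d i k \<omega>" "D k \<omega>"] d_le[OF that w, of k] \<beta>_pos[of k]
        by (simp add: \<xi>_def)
      then have "(\<Sum>i\<in>?V. norm (\<xi> k \<omega> i)) \<le> (\<Sum>i\<in>?V. \<beta> k * (2 * l))" by (intro sum_mono) auto
      then show ?thesis using L2_vec_le_sum[of ?V "\<xi> k \<omega>"] by (simp add: mult_ac)
    qed
    show "L2_vec ?V (\<eta> 0 \<omega>) \<le> L2_vec ?V (\<lambda>i. x0 i - (1 / real N) *\<^sub>R (\<Sum>i\<in>?V. x0 i))" if "\<omega> \<in> space M" for \<omega>
      by (rule eq_refl, rule L2_vec_cong) (simp add: \<eta>_def q_def init that)
  qed (use l in auto)

  \<comment> \<open>Convergence of the average and of all agents on a good path\<close>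
  with AE_space show ?thesis
  proof (eventually_elim, goal_cases)
    case (1 \<omega>)
    obtain z0 where "z0 \<in> Xopt" using nonempty by blast
    then have opt: "(\<Sum>i\<in>?V. f i z0) \<le> (\<Sum>i\<in>?V. f i z)" for z
      by (auto simp: Xopt is_arg_min_def not_less)
    have le: "norm (x i k \<omega> - q k \<omega>) \<le> L2_vec ?V (\<eta> k \<omega>)" if "i \<in> ?V" for i k
      using norm_le_L2_vec[OF V(1) that, of "\<eta> k \<omega>"] by (simp add: \<eta>_def)
    have "\<exists>zs. (\<forall>z. (\<Sum>i\<in>?V. f i zs) \<le> (\<Sum>i\<in>?V. f i z)) \<and> (\<lambda>k. q k \<omega>) \<longlonglongrightarrow> zs"
    proof (rule subgradient_method_converges[OF V l lip])
      show "d i k \<omega> \<in> subdifferential (f i) (x i k \<omega>)" if "i \<in> ?V" for i k by (rule subgradient[OF that 1(1)])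
      show "norm (d i k \<omega>) \<le> l" if "i \<in> ?V" for i k by (rule d_le[OF that 1(1)])
      show "q (Suc k) \<omega> = q k \<omega> - (\<beta> k / real (card ?V)) *\<^sub>R (\<Sum>i\<in>?V. d i k \<omega>)" for k
        by (simp add: q_Suc[OF 1(1)] D_def)
      show "norm (x i k \<omega> - q k \<omega>) \<le> L2_vec ?V (\<eta> k \<omega>)" if "i \<in> ?V" for i k by (rule le[OF that])
      show "summable (\<lambda>k. \<beta> k * L2_vec ?V (\<eta> k \<omega>))" using 1(2) by simp
      show "(\<Sum>i\<in>?V. f i z0) \<le> (\<Sum>i\<in>?V. f i z)" for z by (rule opt)
    qed (use \<beta>_pos \<beta>_div \<beta>_sq in \<open>auto simp: less_imp_le\<close>)
    then obtain zs where zs: "\<And>z. (\<Sum>i\<in>?V. f i zs) \<le> (\<Sum>i\<in>?V. f i z)" "(\<lambda>k. q k \<omega>) \<longlonglongrightarrow> zs" by blast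
    have "(\<lambda>k. x i k \<omega>) \<longlonglongrightarrow> zs" if "i \<in> ?V" for i
    proof -
      have "(\<lambda>k. x i k \<omega> - q k \<omega>) \<longlonglongrightarrow> 0"
        by (rule Lim_null_comparison[OF _ conjunct2[OF 1(2)]]) (use le[OF that] in auto)
      from tendsto_add[OF this zs(2)] show ?thesis by simp
    qed
    moreover have "zs \<in> Xopt" using zs(1) by (auto simp: Xopt is_arg_min_def not_less)
    ultimately show ?case by blast
  qed
qed

end
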